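(* Let $R$ be a Dedekind domain with fraction field $K$, let $\mathbf{X}\in R^{n\times n}$ be a symmetric matrix, and suppose that $\mathbf{Y}\in R^{n\times n}$ and a nonzero matrix $\mathbf{Q}\in K^{n\times n}$ satisfy $\mathbf{X}\mathbf{Q}=\mathbf{Q}\mathbf{Y}$ and $\mathbf{Q}^{\mathsf T}\mathbf{Q}\in R^{n\times n}$. Let $\mathcal{L}\subseteq R$ be the level of $\mathbf{Q}$. Suppose that $\Delta_{\mathbf{X}}\neq 0$ and that in the factorization $\Delta_{\mathbf{X}}R=\prod_i\mathcal{P}_i^{e_i}$ into powers of distinct nonzero prime ideals every exponent satisfies $e_i\leq 1$. Then $\mathcal{L}=R$.
   Context: Rings are commutative and unital. A Dedekind domain is a Noetherian integral domain in which every nonzero proper ideal factors as a product of powers of nonzero prime ideals (uniquely up to reordering). The level of $\mathbf{Q}$ is the ideal $\mathcal{L}=\{r\in R: r\mathbf{Q}\in R^{n\times n}\}$. With $\phi_{\mathbf{X}}(x)=\det(x\mathbf{I}-\mathbf{X})$ and $\phi_{\mathbf{X}}'$ its formal derivative, the discriminant is $\Delta_{\mathbf{X}}=\det(\phi_{\mathbf{X}}'(\mathbf{X}))\in R$. *)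

theory Defs
  imports
    "HOL-Computational_Algebra.Polynomial_Factorial"
    "HOL-Algebra.Ideal_Product"
    "HOL-Algebra.Ring_Divisibility"
    "Jordan_Normal_Form.Char_Poly"
    "Jordan_Normal_Form.VS_Connect"
begin

text \<open>
  A factorization \<open>I = \<Prod> P ^ (e P)\<close> into powers of distinct nonzero prime ideals is given by its
  exponent function \<open>e\<close>, which sends every other set to 0. Two factorizations have
  the same exponent function iff they agree up to the order of the factors. The whole ring has
  the empty factorization \<open>e = (\<lambda>P. 0)\<close>.
\<close>

definition prime_ideal_factorization ::
  "('a, 'b) ring_scheme \<Rightarrow> 'a set \<Rightarrow> ('a set \<Rightarrow> nat) \<Rightarrow> bool" where
  "prime_ideal_factorization R I e \<longleftrightarrow>
     finite {P. e P > 0} \<and>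
     (\<forall>P. e P > 0 \<longrightarrow> primeideal P R \<and> P \<noteq> {\<zero>\<^bsub>R\<^esub>}) \<and>
     I = (\<Otimes>\<^bsub>ideals_set R\<^esub>P\<in>{P. e P > 0}. P [^]\<^bsub>ideals_set R\<^esub> e P)"

definition dedekind_domain :: "('a, 'b) ring_scheme \<Rightarrow> bool" where
  "dedekind_domain R \<longleftrightarrow>
     noetherian_domain R \<and>
     (\<forall>I. ideal I R \<and> I \<noteq> {\<zero>\<^bsub>R\<^esub>} \<and> I \<noteq> carrier R \<longrightarrow>
        (\<exists>!e. prime_ideal_factorization R I e))"

definition integral_mat :: "'r::idom fract mat \<Rightarrow> bool" where
  "integral_mat A \<longleftrightarrow> elements_mat A \<subseteq> range to_fract"

definition mat_level :: "'r::idom fract mat \<Rightarrow> 'r set" where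
  "mat_level Q = {r. integral_mat (to_fract r \<cdot>\<^sub>m Q)}"

lemma integral_mat_iff:
  "integral_mat A \<longleftrightarrow> (\<forall>i<dim_row A. \<forall>j<dim_col A. A $$ (i,j) \<in> range to_fract)"
  unfolding integral_mat_def elements_mat_def by fastforce

lemma ideal_mat_level: "ideal (mat_level (Q :: 'r::idom fract mat)) class_ring"
proof -
  let ?L = "mat_level Q"
  have lev: "r \<in> ?L \<longleftrightarrow>
      (\<forall>i<dim_row Q. \<forall>j<dim_col Q. to_fract r * Q $$ (i,j) \<in> range to_fract)" for r
    unfolding mat_level_def integral_mat_iff by simp
  have zero: "0 \<in> ?L"
    unfolding lev using rangeI[of to_fract "0 :: 'r"] by simp
  have rminus: "- u \<in> range to_fract" if "u \<in> range to_fract" for u :: "'r fract"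
    using that by (auto simp flip: to_fract_uminus)
  have rplus: "u + v \<in> range to_fract" if "u \<in> range to_fract" "v \<in> range to_fract"
    for u v :: "'r fract"
    using that by (auto simp flip: to_fract_add)
  have rtimes: "to_fract x * u \<in> range to_fract" if "u \<in> range to_fract"
    for x and u :: "'r fract"
    using that by (auto simp flip: to_fract_mult)
  have minus: "- a \<in> ?L" if "a \<in> ?L" for a
    using that rminus unfolding lev by simp
  have plus: "a + b \<in> ?L" if "a \<in> ?L" "b \<in> ?L" for a b
    using that rplus unfolding lev by (simp add: distrib_right)
  have times: "x * a \<in> ?L" if "a \<in> ?L" for a x
    using that rtimes unfolding lev by (simp add: mult.assoc)
  show ?thesis
  proof (rule idealI)
    show "ring (class_ring :: 'r ring)" by (rule class_ring.ring_axioms)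
    have grp: "Group.group (add_monoid (class_ring :: 'r ring))"
      using class_ring.ring_axioms by (intro abelian_group.a_group ring.axioms(1))
    show "subgroup ?L (add_monoid (class_ring :: 'r ring))"
    proof (rule group.subgroupI[OF grp])
      show "?L \<noteq> {}" using zero by blast
      fix a assume "a \<in> ?L"
      moreover have "- a = inv\<^bsub>add_monoid class_ring\<^esub> a"
        by (rule group.inv_equality[OF grp, symmetric]) auto
      ultimately show "inv\<^bsub>add_monoid class_ring\<^esub> a \<in> ?L"
        using minus by metis
    qed (use plus in simp_all)
  next
    fix a x :: 'r assume "a \<in> ?L"
    then show "x \<otimes>\<^bsub>class_ring\<^esub> a \<in> ?L" "a \<otimes>\<^bsub>class_ring\<^esub> x \<in> ?L"
      using times[of a x] by (simp_all add: mult.commute)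
  qed
qed

definition poly_mat :: "'a::comm_ring_1 poly \<Rightarrow> 'a mat \<Rightarrow> 'a mat" where
  "poly_mat p A =
     mat (dim_row A) (dim_row A)
       (\<lambda>ij. \<Sum>k\<le>degree p. poly.coeff p k * (A ^\<^sub>m k) $$ ij)"

definition mat_discriminant :: "'a::idom mat \<Rightarrow> 'a" where
  "mat_discriminant X = det (poly_mat (pderiv (char_poly X)) X)"

end

(*
  Suppose the level lies in a nonzero prime P. Some multiple M = a Q has entries in R, not all in P,
  and M^T M = 0 modulo the square of P (locally at P). So modulo P the image V of M is a nonzero
  X-invariant totally isotropic subspace. A polynomial g that is monic of least degree annihilating
  some nonzero v in V modulo P is irreducible there. In the basis with first vector
  u = (g(x) - g(X))/(x - X) v, the first row and column of the symmetric matrix x - X lie in the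
  maximal ideal m = (P, g) of R[x] and the corner entry vanishes modulo P; hence the characteristic
  polynomial lies in m^2 + P R[x], its derivative lies in m, and S = phi'(X) kills v modulo P.
  As S v again lies in the image of M, the symmetric matrix S has, in a basis with first vector v,
  its first row and column in P and its corner entry in P^2. Therefore det S lies in P^2.

  No residue field or localization is formed: a uniformizer at P is replaced by a pair alpha in P,
  beta not in P with beta P contained in alpha R.
*)
theory Submission
  imports Defs
begin

section \<open>Ideals and prime factorization\<close>

text \<open>If X had an eigenvalue c on V in the residue field, an isotropic eigenvector would make
  c a double root of the characteristic polynomial modulo P. No such c need exist, so g takes the
  place of x - c: modulo m the vector u is an eigenvector of X with eigenvalue x. Its coefficient
  vectors lie in V, so isotropy gives v . u = 0 and thereby u . (x - X) u = g (v . u) = 0 modulo P.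
  The same determinant lemma serves over R[x] with the ideal m and over R with P. The second use
  needs precision P^2, which comes from M^T M = a^2 Q^T Q: the factor a lies in the level, hence in
  P. No division by 2 occurs, so residue characteristic 2 is covered. The contradiction compares
  this with the exponent of P in the discriminant, which is at most 1. Since a Dedekind domain is
  given here by unique factorization, the maximality of nonzero primes, and with it inverses modulo
  P, has to be derived from cancellation of ideals.\<close>

lemma ideal_class_ring_iff:
  "ideal I (class_ring :: 'a::comm_ring_1 ring) \<longleftrightarrow>
     0 \<in> I \<and> (\<forall>x\<in>I. \<forall>y\<in>I. x + y \<in> I) \<and> (\<forall>a. \<forall>x\<in>I. a * x \<in> I)" (is "?L \<longleftrightarrow> ?R")
proof
  assume ?L
  then interpret ideal I "class_ring :: 'a ring" .
  show ?R
    using zero_closed a_closed I_l_closed by simp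
next
  assume R: ?R
  have minus: "- x \<in> I" if "x \<in> I" for x
    using R that by (metis mult_minus1)
  have grp: "Group.group (add_monoid (class_ring :: 'a ring))"
    using class_ring.ring_axioms by (intro abelian_group.a_group ring.axioms(1))
  show ?L
  proof (rule idealI)
    show "ring (class_ring :: 'a ring)" by (rule class_ring.ring_axioms)
    show "subgroup I (add_monoid (class_ring :: 'a ring))"
    proof (rule group.subgroupI[OF grp])
      fix a assume "a \<in> I"
      moreover have "- a = inv\<^bsub>add_monoid class_ring\<^esub> a"
        by (rule group.inv_equality[OF grp, symmetric]) auto
      ultimately show "inv\<^bsub>add_monoid class_ring\<^esub> a \<in> I"
        using minus by metis
    qed (use R in auto)
  next
    fix a x assume "a \<in> I"
    then show "x \<otimes>\<^bsub>class_ring\<^esub> a \<in> I" "a \<otimes>\<^bsub>class_ring\<^esub> x \<in> I"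
      using R by (simp_all add: mult.commute[of a])
  qed
qed

context
  fixes I :: "'a::comm_ring_1 set"
  assumes I: "ideal I class_ring"
begin

lemma class_ideal_zero: "0 \<in> I"
  and class_ideal_add: "x \<in> I \<Longrightarrow> y \<in> I \<Longrightarrow> x + y \<in> I"
  and class_ideal_mult: "x \<in> I \<Longrightarrow> a * x \<in> I"
  and class_ideal_mult': "x \<in> I \<Longrightarrow> x * a \<in> I"
  using I unfolding ideal_class_ring_iff by (auto simp: mult.commute)

lemma class_ideal_uminus: "x \<in> I \<Longrightarrow> - x \<in> I"
  using class_ideal_mult[of x "-1"] by simp

lemma class_ideal_diff: "x \<in> I \<Longrightarrow> y \<in> I \<Longrightarrow> x - y \<in> I"
  using class_ideal_add[of x "-y"] class_ideal_uminus by simp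

lemma class_ideal_sum: "(\<And>i. i \<in> A \<Longrightarrow> f i \<in> I) \<Longrightarrow> sum f A \<in> I"
  by (induction A rule: infinite_finite_induct) (auto intro: class_ideal_zero class_ideal_add)

lemma class_ideal_prod: "finite A \<Longrightarrow> i \<in> A \<Longrightarrow> f i \<in> I \<Longrightarrow> prod f A \<in> I"
  by (subst prod.remove[of _ i]) (auto intro: class_ideal_mult')

lemma class_ideal_scalar_prod:
  "dim_vec w = n \<Longrightarrow> (\<And>i. i < n \<Longrightarrow> w $ i \<in> I) \<Longrightarrow> v \<bullet> w \<in> I"
  unfolding scalar_prod_def by (rule class_ideal_sum) (auto intro: class_ideal_mult)

end

lemma primeideal_class_ring_iff:
  "primeideal P (class_ring :: 'a::comm_ring_1 ring) \<longleftrightarrow>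
     ideal P class_ring \<and> P \<noteq> UNIV \<and> (\<forall>a b. a * b \<in> P \<longrightarrow> a \<in> P \<or> b \<in> P)"
proof -
  have "cring (class_ring :: 'a ring)"
    by (rule class_cring.cring_axioms)
  then show ?thesis
    by (auto simp: primeideal_def primeideal_axioms_def)
qed

lemma class_ideal_mult_mat_vec:
  assumes I: "ideal I (class_ring :: 'a::comm_ring_1 ring)"
    and "A \<in> carrier_mat m n" "w \<in> carrier_vec n" "i < m"
    and "\<And>j. j < n \<Longrightarrow> A $$ (i,j) \<in> I"
  shows "(A *\<^sub>v w) $ i \<in> I"
  using assms by (auto simp: scalar_prod_def intro!: class_ideal_sum[OF I] class_ideal_mult'[OF I])

lemma cring_class_ring: "cring (class_ring :: 'a::comm_ring_1 ring)"
  by (rule class_cring.cring_axioms)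

lemma ring_class_ring: "ring (class_ring :: 'a::comm_ring_1 ring)"
  by (rule class_ring.ring_axioms)

section \<open>Products and prime factorizations in the monoid of ideals\<close>

abbreviation ideal_monoid :: "'r::idom set ring" where
  "ideal_monoid \<equiv> ideals_set class_ring"

interpretation ideal_monoid: comm_monoid "ideal_monoid :: 'r::idom set ring"
  by (rule cring.ideals_set_is_comm_monoid[OF cring_class_ring])

lemma ideal_monoid_simps [simp]:
  "carrier ideal_monoid = {I. ideal I class_ring}"
  "\<one>\<^bsub>ideal_monoid\<^esub> = UNIV"
  "I \<otimes>\<^bsub>ideal_monoid\<^esub> J = I \<cdot>\<^bsub>class_ring\<^esub> J"
  by (simp_all add: ideals_set_def)

lemma mem_cgenideal_class_ring: "x \<in> PIdl\<^bsub>class_ring\<^esub> a \<longleftrightarrow> a dvd (x :: 'a::comm_ring_1)"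
  by (auto simp: cgenideal_def dvd_def mult.commute)

lemma mem_set_add_class_ring: "x \<in> I <+>\<^bsub>class_ring\<^esub> J \<longleftrightarrow> (\<exists>i\<in>I. \<exists>j\<in>J. x = i + (j :: 'a::comm_ring_1))"
  by (auto simp: set_add_def' )

lemma ideal_prod_subsetI:
  assumes "ideal K (class_ring :: 'a::comm_ring_1 ring)" "\<And>i j. i \<in> I \<Longrightarrow> j \<in> J \<Longrightarrow> i * j \<in> K"
  shows "I \<cdot>\<^bsub>class_ring\<^esub> J \<subseteq> K"
proof
  fix x assume "x \<in> I \<cdot>\<^bsub>class_ring\<^esub> J"
  then show "x \<in> K"
    by induction (use assms class_ideal_add[OF assms(1)] in auto)
qed

lemma mult_mem_ideal_prod: "i \<in> I \<Longrightarrow> j \<in> J \<Longrightarrow> i * j \<in> I \<cdot>\<^bsub>class_ring\<^esub> (J :: 'a::comm_ring_1 set)"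
  using ideal_prod.prod[of i I j J class_ring] by simp

lemma ideal_pow_closed: "ideal P class_ring \<Longrightarrow> ideal (P [^]\<^bsub>ideal_monoid\<^esub> (k::nat)) class_ring"
  using ideal_monoid.nat_pow_closed[of P k] by simp

lemma prime_ideal_factorization_idealD:
  assumes "prime_ideal_factorization class_ring I e" "0 < e Q"
  shows "ideal Q (class_ring :: 'r::idom ring)"
  using assms by (auto simp: prime_ideal_factorization_def primeideal_def)

text \<open>Indices with exponent 0 contribute the unit ideal. This brings two factorizations to a
  common index set, where they can be multiplied factor by factor.\<close>

lemma prime_ideal_factorization_superset:
  assumes e: "prime_ideal_factorization class_ring I e"
    and S: "finite S" "{P. 0 < e P} \<subseteq> S" "\<And>P. P \<in> S \<Longrightarrow> ideal P (class_ring :: 'r::idom ring)"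
  shows "I = (\<Otimes>\<^bsub>ideal_monoid\<^esub>P\<in>S. P [^]\<^bsub>ideal_monoid\<^esub> e P)"
proof -
  have "I = (\<Otimes>\<^bsub>ideal_monoid\<^esub>P\<in>{P. 0 < e P}. P [^]\<^bsub>ideal_monoid\<^esub> e P)"
    using e by (simp add: prime_ideal_factorization_def)
  also have "\<dots> = (\<Otimes>\<^bsub>ideal_monoid\<^esub>P\<in>S. P [^]\<^bsub>ideal_monoid\<^esub> e P)"
    using S by (intro ideal_monoid.finprod_mono_neutral_cong_left) (auto intro: ideal_pow_closed)
  finally show ?thesis .
qed

lemma prime_ideal_factorization_mult:
  assumes e: "prime_ideal_factorization class_ring I e" and f: "prime_ideal_factorization class_ring J f"
  shows "prime_ideal_factorization (class_ring :: 'r::idom ring) (I \<cdot>\<^bsub>class_ring\<^esub> J) (\<lambda>P. e P + f P)"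
proof -
  let ?S = "{P. 0 < e P + f P}"
  have S: "?S = {P. 0 < e P} \<union> {P. 0 < f P}"
    by auto
  then have fin: "finite ?S"
    using e f by (simp add: prime_ideal_factorization_def)
  have id: "ideal P class_ring" if "P \<in> ?S" for P
    using that e f by (auto intro: prime_ideal_factorization_idealD)
  have "I = (\<Otimes>\<^bsub>ideal_monoid\<^esub>P\<in>?S. P [^]\<^bsub>ideal_monoid\<^esub> e P)"
    using id by (intro prime_ideal_factorization_superset[OF e fin]) auto
  moreover have "J = (\<Otimes>\<^bsub>ideal_monoid\<^esub>P\<in>?S. P [^]\<^bsub>ideal_monoid\<^esub> f P)"
    using id by (intro prime_ideal_factorization_superset[OF f fin]) auto
  ultimately have "I \<cdot>\<^bsub>class_ring\<^esub> J =
      (\<Otimes>\<^bsub>ideal_monoid\<^esub>P\<in>?S. (P [^]\<^bsub>ideal_monoid\<^esub> e P) \<otimes>\<^bsub>ideal_monoid\<^esub> (P [^]\<^bsub>ideal_monoid\<^esub> f P))"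
    using id by (subst ideal_monoid.finprod_multf) (auto intro: ideal_pow_closed)
  also have "\<dots> = (\<Otimes>\<^bsub>ideal_monoid\<^esub>P\<in>?S. P [^]\<^bsub>ideal_monoid\<^esub> (e P + f P))"
  proof (rule ideal_monoid.finprod_cong')
    fix P assume "P \<in> ?S"
    then show "(P [^]\<^bsub>ideal_monoid\<^esub> e P) \<otimes>\<^bsub>ideal_monoid\<^esub> (P [^]\<^bsub>ideal_monoid\<^esub> f P) =
        P [^]\<^bsub>ideal_monoid\<^esub> (e P + f P)"
      using ideal_monoid.nat_pow_mult[of P "e P" "f P"] id[of P] by simp
  qed (use id in \<open>auto intro: ideal_pow_closed\<close>)
  finally show ?thesis
    using e f fin by (auto simp: prime_ideal_factorization_def)
qed

lemma prime_ideal_factorization_UNIV: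
  "prime_ideal_factorization (class_ring :: 'r::idom ring) UNIV (\<lambda>P. 0)"
  by (simp add: prime_ideal_factorization_def)

lemma prime_ideal_factorization_prime:
  assumes "primeideal P (class_ring :: 'r::idom ring)" "P \<noteq> {0}"
  shows "prime_ideal_factorization class_ring P (\<lambda>Q. if Q = P then 1 else 0 :: nat)"
proof -
  have "ideal P class_ring"
    using assms by (simp add: primeideal_def)
  moreover have "{Q. 0 < (if Q = P then 1 else 0 :: nat)} = {P}"
    by auto
  moreover from this have "(\<Otimes>\<^bsub>ideal_monoid\<^esub>Q\<in>{P}. Q [^]\<^bsub>ideal_monoid\<^esub> (if Q = P then 1 else 0 :: nat)) = P"
    using \<open>ideal P class_ring\<close> ideal_monoid.nat_pow_eone[of P]
    by (subst ideal_monoid.finprod_insert) (auto simp: ideal_monoid.r_one[of P, simplified])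
  ultimately show ?thesis
    using assms by (simp add: prime_ideal_factorization_def)
qed

lemma prime_ideal_factorization_split:
  assumes e: "prime_ideal_factorization class_ring I e" and P: "0 < e P"
  defines "J \<equiv> \<Otimes>\<^bsub>ideal_monoid\<^esub>Q\<in>{Q. 0 < e Q} - {P}. Q [^]\<^bsub>ideal_monoid\<^esub> e Q"
  shows "ideal J (class_ring :: 'r::idom ring)" "I = (P [^]\<^bsub>ideal_monoid\<^esub> e P) \<cdot>\<^bsub>class_ring\<^esub> J"
proof -
  note id = prime_ideal_factorization_idealD[OF e]
  show "ideal J class_ring"
    using ideal_monoid.finprod_closed[of "\<lambda>Q. Q [^]\<^bsub>ideal_monoid\<^esub> e Q" "{Q. 0 < e Q} - {P}"] id
    by (auto simp: J_def intro: ideal_pow_closed)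
  have "I = (\<Otimes>\<^bsub>ideal_monoid\<^esub>Q\<in>insert P ({Q. 0 < e Q} - {P}). Q [^]\<^bsub>ideal_monoid\<^esub> e Q)"
    using e P by (simp add: prime_ideal_factorization_def insert_absorb)
  also have "\<dots> = (P [^]\<^bsub>ideal_monoid\<^esub> e P) \<cdot>\<^bsub>class_ring\<^esub> J"
    unfolding J_def using e P id
    by (subst ideal_monoid.finprod_insert)
      (auto simp: prime_ideal_factorization_def intro: ideal_pow_closed)
  finally show "I = (P [^]\<^bsub>ideal_monoid\<^esub> e P) \<cdot>\<^bsub>class_ring\<^esub> J" .
qed

lemma ideal_pow_subset_prime:
  assumes P: "primeideal P (class_ring :: 'r::idom ring)" and Q: "ideal Q class_ring"
    and sub: "Q [^]\<^bsub>ideal_monoid\<^esub> (k::nat) \<subseteq> P"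
  shows "Q \<subseteq> P"
  using sub
proof (induction k)
  case 0
  then show ?case
    using P by (auto simp: primeideal_class_ring_iff)
next
  case (Suc k)
  then have "(Q [^]\<^bsub>ideal_monoid\<^esub> k) \<cdot>\<^bsub>class_ring\<^esub> Q \<subseteq> P"
    by (simp add: ideal_monoid.nat_pow_Suc)
  then show ?case
    using ring.primeideal_divides_ideal_prod[OF ring_class_ring P ideal_pow_closed[OF Q] Q] Suc.IH by blast
qed

lemma finprod_ideal_subset_prime:
  assumes P: "primeideal P (class_ring :: 'r::idom ring)" and "finite S"
    and "\<And>Q. Q \<in> S \<Longrightarrow> ideal (f Q) class_ring"
    and "finprod ideal_monoid f S \<subseteq> P"
  shows "\<exists>Q\<in>S. f Q \<subseteq> P"
  using assms(2-4)
proof (induction S)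
  case empty
  then show ?case
    using P by (auto simp: primeideal_class_ring_iff)
next
  case (insert Q S)
  then have *: "f \<in> S \<rightarrow> carrier ideal_monoid" "ideal (f Q) class_ring"
    by auto
  moreover have "ideal (finprod ideal_monoid f S) class_ring"
    using ideal_monoid.finprod_closed[OF *(1)] by simp
  moreover have "f Q \<cdot>\<^bsub>class_ring\<^esub> finprod ideal_monoid f S \<subseteq> P"
    using insert.prems(2) * by (simp add: ideal_monoid.finprod_insert[OF insert.hyps])
  ultimately have "f Q \<subseteq> P \<or> finprod ideal_monoid f S \<subseteq> P"
    using ring.primeideal_divides_ideal_prod[OF ring_class_ring P] by blast
  then show ?case
    using insert by auto
qed

section \<open>Dedekind domains: cancellation, maximality of primes, local uniformizers\<close>

context
  assumes dedekind: "dedekind_domain (class_ring :: 'r::idom ring)"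
begin

lemma nonzero_ideal_factorization:
  assumes "ideal I (class_ring :: 'r ring)" "I \<noteq> {0}"
  obtains e where "prime_ideal_factorization class_ring I e"
proof (cases "I = UNIV")
  case True
  then show ?thesis
    using that prime_ideal_factorization_UNIV by blast
next
  case False
  then have "\<exists>!e. prime_ideal_factorization class_ring I e"
    using assms dedekind by (simp add: dedekind_domain_def)
  then show ?thesis
    using that by blast
qed

lemma prime_ideal_factorization_unique:
  assumes "ideal I (class_ring :: 'r ring)" "I \<noteq> {0}" "I \<noteq> UNIV"
    and "prime_ideal_factorization class_ring I e" "prime_ideal_factorization class_ring I f"
  shows "e = f"
  using assms dedekind by (auto simp: dedekind_domain_def)

text \<open>Exponents of a product are sums, and sums of natural numbers cancel. Properness of A
  keeps the product proper, and it is nonzero in a domain, so uniqueness of exponents applies to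
  it.\<close>

lemma ideal_prod_cancel:
  assumes A: "ideal A (class_ring :: 'r ring)" "A \<noteq> {0}" "A \<noteq> UNIV"
    and B: "ideal B class_ring" "B \<noteq> {0}" and C: "ideal C class_ring" "C \<noteq> {0}"
    and eq: "A \<cdot>\<^bsub>class_ring\<^esub> B = A \<cdot>\<^bsub>class_ring\<^esub> C"
  shows "B = C"
proof -
  obtain a where a: "prime_ideal_factorization class_ring A a"
    using nonzero_ideal_factorization[OF A(1,2)] .
  obtain b where b: "prime_ideal_factorization class_ring B b"
    using nonzero_ideal_factorization[OF B] .
  obtain c where c: "prime_ideal_factorization class_ring C c"
    using nonzero_ideal_factorization[OF C] .
  let ?D = "A \<cdot>\<^bsub>class_ring\<^esub> B"
  obtain x where x: "x \<in> A" "x \<noteq> 0" using A(2) class_ideal_zero[OF A(1)] by auto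
  obtain y where y: "y \<in> B" "y \<noteq> 0" using B(2) class_ideal_zero[OF B(1)] by auto
  have "x * y \<in> ?D" "x * y \<noteq> 0"
    using x y by (auto intro: mult_mem_ideal_prod)
  then have "?D \<noteq> {0}" by blast
  moreover have "?D \<noteq> UNIV"
    using ring.ideal_prod_inter[OF ring_class_ring A(1) B(1)] A(3) by auto
  moreover have "ideal ?D class_ring"
    by (rule ring.ideal_prod_is_ideal[OF ring_class_ring A(1) B(1)])
  ultimately have "(\<lambda>P. a P + b P) = (\<lambda>P. a P + c P)"
    using prime_ideal_factorization_mult[OF a b] prime_ideal_factorization_mult[OF a c] eq
    by (intro prime_ideal_factorization_unique[of ?D]) auto
  then have "b = c"
    by (metis add_left_cancel ext)
  then show ?thesis
    using b c by (simp add: prime_ideal_factorization_def)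
qed

text \<open>Ideals cancel by unique factorization. With \<open>A = aR\<close> and \<open>P + A\<close> proper, cancelling
  \<open>P + A\<close> from \<open>(P + A) (P\<^sup>2 + A\<^sup>2) = (P + A)\<^sup>3\<close> yields \<open>PA \<subseteq> P\<^sup>2 + A\<^sup>2\<close>, and since \<open>P\<close> is prime even
  \<open>P (P + A\<^sup>2) = P (P + A)\<close>; cancelling \<open>P\<close> leaves \<open>a \<in> P + a\<^sup>2R\<close>.\<close>

lemma nonzero_prime_unit:
  assumes prime: "primeideal P (class_ring :: 'r ring)" and P0: "P \<noteq> {0}" and a: "a \<notin> P"
  shows "\<exists>b. a * b - 1 \<in> P"
proof -
  interpret S: semiring "ideal_monoid :: 'r set ring"
    by (rule cring.ideals_set_is_semiring[OF cring_class_ring])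
  define A where "A = PIdl\<^bsub>class_ring\<^esub> a"
  let ?add = "(\<lambda>I J. I <+>\<^bsub>class_ring\<^esub> J) :: 'r set \<Rightarrow> 'r set \<Rightarrow> 'r set"
  let ?mul = "(\<lambda>I J. I \<cdot>\<^bsub>class_ring\<^esub> J) :: 'r set \<Rightarrow> 'r set \<Rightarrow> 'r set"
  let ?I = "?add P A"
  have P: "ideal P class_ring" "P \<noteq> UNIV" and pr: "\<And>x y. x * y \<in> P \<Longrightarrow> x \<in> P \<or> y \<in> P"
    using prime by (auto simp: primeideal_class_ring_iff)
  have A: "ideal A class_ring"
    unfolding A_def by (rule cring.cgenideal_ideal[OF cring_class_ring]) simp
  have memA: "x \<in> A \<longleftrightarrow> a dvd x" for x
    by (simp add: A_def mem_cgenideal_class_ring)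
  have add: "ideal (?add I J) class_ring" if "ideal I class_ring" "ideal J class_ring" for I J
    using that by (rule ring.add_ideals[OF ring_class_ring])
  have mul: "ideal (?mul I J) class_ring" if "ideal I class_ring" "ideal J class_ring" for I J
    using that by (rule ring.ideal_prod_is_ideal[OF ring_class_ring])
  have sub1: "I \<subseteq> ?add I J" and sub2: "J \<subseteq> ?add I J" if "ideal I class_ring" "ideal J class_ring" for I J
    using class_ideal_zero[OF that(1)] class_ideal_zero[OF that(2)]
    by (force simp: mem_set_add_class_ring)+
  have nz: "I \<noteq> {0}" if "P \<subseteq> I" for I
    using that P0 class_ideal_zero[OF P(1)] by auto
  have absorb: "?add P (?mul A A) = ?add P A" if ne: "?I \<noteq> UNIV"
  proof -
    let ?J = "?add (?mul P P) (?mul A A)"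
    have idem: "I \<oplus>\<^bsub>ideal_monoid\<^esub> I = I" if "ideal I class_ring" for I :: "'r set"
      using that class_ideal_add[OF that] sub1[OF that that] by (force simp: ideals_set_def mem_set_add_class_ring)
    have idem': "I \<oplus>\<^bsub>ideal_monoid\<^esub> (I \<oplus>\<^bsub>ideal_monoid\<^esub> J) = I \<oplus>\<^bsub>ideal_monoid\<^esub> J"
      if "ideal I class_ring" "ideal J class_ring" for I J :: "'r set"
      using S.a_assoc[of I I J] idem[OF that(1)] that by simp
    have carr: "ideal (I \<otimes>\<^bsub>ideal_monoid\<^esub> J) class_ring" "ideal (I \<oplus>\<^bsub>ideal_monoid\<^esub> J) class_ring"
      if "ideal I class_ring" "ideal J class_ring" for I J :: "'r set"
      using that ideal_monoid.m_closed[of I J] S.a_closed[of I J] by simp_all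
    \<comment> \<open>In the semiring of ideals both sides expand to P^3 + P^2 A + P A^2 + A^3,
      because repeated summands collapse.\<close>
    have "(P \<oplus>\<^bsub>ideal_monoid\<^esub> A) \<otimes>\<^bsub>ideal_monoid\<^esub> (P \<otimes>\<^bsub>ideal_monoid\<^esub> P \<oplus>\<^bsub>ideal_monoid\<^esub> A \<otimes>\<^bsub>ideal_monoid\<^esub> A)
      = (P \<oplus>\<^bsub>ideal_monoid\<^esub> A) \<otimes>\<^bsub>ideal_monoid\<^esub> ((P \<oplus>\<^bsub>ideal_monoid\<^esub> A) \<otimes>\<^bsub>ideal_monoid\<^esub> (P \<oplus>\<^bsub>ideal_monoid\<^esub> A))"
      using P(1) A idem idem'
      by (simp add: S.l_distr S.r_distr S.a_ac ideal_monoid.m_ac carr del: ideal_monoid_simps(3))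
    then have "?mul ?I ?J = ?mul ?I (?mul ?I ?I)"
      by (simp add: ideals_set_def)
    then have J: "?J = ?mul ?I ?I"
    proof (rule ideal_prod_cancel[rotated -1])
      obtain p where p: "p \<in> P" "p * p \<noteq> 0"
        using nz[of P] class_ideal_zero[OF P(1)] by fastforce
      have "p * p \<in> ?J"
        using p sub1[OF mul[OF P(1) P(1)] mul[OF A A]] by (auto intro: mult_mem_ideal_prod)
      then show "?J \<noteq> {0}" using p by blast
      have "p * p \<in> ?mul ?I ?I"
        using p sub1[OF P(1) A] by (auto intro: mult_mem_ideal_prod)
      then show "?mul ?I ?I \<noteq> {0}" using p by blast
    qed (use ne P A nz sub1 in \<open>auto intro: add mul\<close>)
    have K: "ideal (?mul P (?add P (?mul A A))) class_ring"
      using P(1) A by (intro mul add)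
    have PP: "?mul P P \<subseteq> ?mul P (?add P (?mul A A))"
      using sub1[OF P(1) mul[OF A A]] by (intro ideal_prod_subsetI[OF K]) (auto intro: mult_mem_ideal_prod)
    have PA: "?mul P A \<subseteq> ?mul P (?add P (?mul A A))"
    proof (rule ideal_prod_subsetI[OF K])
      fix p x assume p: "p \<in> P" and "x \<in> A"
      then obtain r where x: "x = a * r" by (auto simp: memA)
      let ?p = "p * r"
      have pr': "?p \<in> P" using class_ideal_mult'[OF P(1) p] .
      have "?p * a \<in> ?mul ?I ?I"
        using pr' sub1[OF P(1) A] sub2[OF P(1) A] memA[of a] by (intro mult_mem_ideal_prod) auto
      then obtain q s where q: "q \<in> ?mul P P" and s: "s \<in> ?mul A A" and eq: "?p * a = q + s"
        by (auto simp: J[symmetric] mem_set_add_class_ring)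
      have "?mul A A \<subseteq> PIdl\<^bsub>class_ring\<^esub> (a * a)"
        by (rule ideal_prod_subsetI[OF cring.cgenideal_ideal[OF cring_class_ring]])
          (auto simp: memA mem_cgenideal_class_ring intro: mult_dvd_mono)
      then have "s \<in> PIdl\<^bsub>class_ring\<^esub> (a * a)"
        using s by (rule subsetD)
      then obtain t where t: "s = a * a * t"
        unfolding mem_cgenideal_class_ring by (rule dvdE)
      have "q \<in> P"
        using ring.ideal_prod_inter[OF ring_class_ring P(1) P(1)] q by auto
      then have "s \<in> P"
        using eq class_ideal_diff[OF P(1) class_ideal_mult'[OF P(1) pr']] by (metis add_diff_cancel_left')
      \<comment> \<open>Here s = a^2 t lies in P and a does not, so t is in P; this places s in P
        A^2.\<close>
      then have tP: "t \<in> P"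
        using pr a unfolding t by blast
      have "q \<in> ?mul P (?add P (?mul A A))"
        using q PP by auto
      moreover have "t * (a * a) \<in> ?mul P (?add P (?mul A A))"
        using tP sub2[OF P(1) mul[OF A A]] memA[of a] by (intro mult_mem_ideal_prod) (auto intro: mult_mem_ideal_prod)
      ultimately have "q + t * (a * a) \<in> ?mul P (?add P (?mul A A))"
        by (rule class_ideal_add[OF K])
      then show "p * x \<in> ?mul P (?add P (?mul A A))"
        using eq t x by (simp add: mult_ac)
    qed
    have "?mul P (?add P (?mul A A)) = ?mul P (?add P A)"
    proof (rule antisym)
      have "?add P (?mul A A) \<subseteq> ?add P A"
        using ring.ideal_prod_inter[OF ring_class_ring A A] unfolding subset_iff mem_set_add_class_ring
        by blast
      then show "?mul P (?add P (?mul A A)) \<subseteq> ?mul P (?add P A)"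
        using mul[OF P(1) add[OF P(1) A]] by (intro ideal_prod_subsetI) (auto intro: mult_mem_ideal_prod)
      show "?mul P (?add P A) \<subseteq> ?mul P (?add P (?mul A A))"
      proof (rule ideal_prod_subsetI[OF K])
        fix i j assume i: "i \<in> P" and "j \<in> ?add P A"
        then obtain p x where "p \<in> P" "x \<in> A" and j: "j = p + x"
          by (auto simp: mem_set_add_class_ring)
        then have "i * p + i * x \<in> ?mul P (?add P (?mul A A))"
          using PP PA mult_mem_ideal_prod[OF i] by (intro class_ideal_add[OF K]) auto
        then show "i * j \<in> ?mul P (?add P (?mul A A))"
          by (simp add: j distrib_left)
      qed
    qed
    then show ?thesis
      by (rule ideal_prod_cancel[OF P(1) P0 P(2) add[OF P(1) mul[OF A A]] nz[OF sub1[OF P(1) mul[OF A A]]]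
            add[OF P(1) A] nz[OF sub1[OF P(1) A]]])
  qed
  show ?thesis
  proof (cases "?I = UNIV")
    case True
    then obtain p x where "p \<in> P" "x \<in> A" "1 = p + x"
      using mem_set_add_class_ring[of 1 P A] by auto
    then obtain b where "1 = p + a * b" by (auto simp: memA)
    then have "a * b - 1 = - p" by (simp add: algebra_simps)
    then show ?thesis
      using class_ideal_uminus[OF P(1) \<open>p \<in> P\<close>] by metis
  next
    case False
    have "a \<in> ?add P (?mul A A)"
      unfolding absorb[OF False] using sub2[OF P(1) A] memA[of a] by auto
    then obtain p s where p: "p \<in> P" and s: "s \<in> ?mul A A" and eq: "a = p + s"
      by (auto simp: mem_set_add_class_ring)
    have "?mul A A \<subseteq> PIdl\<^bsub>class_ring\<^esub> (a * a)"
      by (rule ideal_prod_subsetI[OF cring.cgenideal_ideal[OF cring_class_ring]])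
        (auto simp: memA mem_cgenideal_class_ring intro: mult_dvd_mono)
    then have "s \<in> PIdl\<^bsub>class_ring\<^esub> (a * a)"
      using s by (rule subsetD)
    then obtain t where t: "s = a * a * t"
      unfolding mem_cgenideal_class_ring by (rule dvdE)
    have "a * (a * t - 1) = - p"
      using eq t by (simp add: algebra_simps)
    then have "a * (a * t - 1) \<in> P"
      using class_ideal_uminus[OF P(1) p] by simp
    then show ?thesis
      using pr a by blast
  qed
qed

text \<open>Dimension one: an element of P outside Q would be a unit modulo Q, and Q inside P would
  then force 1 into P.\<close>

lemma nonzero_prime_eq:
  assumes Q: "primeideal Q (class_ring :: 'r ring)" "Q \<noteq> {0}" and P: "primeideal P class_ring" and "Q \<subseteq> P"
  shows "Q = P"
proof (rule ccontr)
  assume "Q \<noteq> P"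
  then obtain a where a: "a \<in> P" "a \<notin> Q" using assms by auto
  obtain b where b: "a * b - 1 \<in> Q" using nonzero_prime_unit[OF Q a(2)] by blast
  have Pi: "ideal P class_ring" "P \<noteq> UNIV"
    using P by (auto simp: primeideal_class_ring_iff)
  have "a * b - (a * b - 1) \<in> P"
    by (rule class_ideal_diff[OF Pi(1) class_ideal_mult'[OF Pi(1) a(1)] subsetD[OF assms(4) b]])
  then have "1 \<in> P" by simp
  then have "x \<in> P" for x
    using class_ideal_mult[OF Pi(1), of 1 x] by simp
  then show False using Pi by auto
qed

text \<open>Locally at P, \<alpha> generates P: by the exponent bound, \<alpha> R is P times a
  cofactor not contained in P, and any element of the cofactor outside P serves as \<beta>. This is
  used for the uniformizer and again for the discriminant.\<close>

lemma simple_prime_factor_cofactor: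
  assumes P: "primeideal P (class_ring :: 'r ring)" and alpha: "\<alpha> \<in> P"
    and e: "prime_ideal_factorization class_ring (PIdl\<^bsub>class_ring\<^esub> \<alpha>) e" and eP: "e P \<le> 1"
  shows "\<exists>\<beta>. \<beta> \<notin> P \<and> (\<forall>p\<in>P. \<alpha> dvd \<beta> * p)"
proof -
  have Pi: "ideal P class_ring"
    using P by (simp add: primeideal_class_ring_iff)
  let ?f = "\<lambda>Q. Q [^]\<^bsub>ideal_monoid\<^esub> e Q"
  have fin: "finite {Q. 0 < e Q}"
    and primes: "\<And>Q. 0 < e Q \<Longrightarrow> primeideal Q class_ring \<and> Q \<noteq> {0}"
    and fac: "PIdl\<^bsub>class_ring\<^esub> \<alpha> = finprod ideal_monoid ?f {Q. 0 < e Q}"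
    using e by (auto simp: prime_ideal_factorization_def)
  note id = prime_ideal_factorization_idealD[OF e]
  \<comment> \<open>A product inside P has a factor Q inside P, and maximality of Q gives Q = P. For
    the set of all factors this shows that P occurs; for the factors other than P it shows that the
    cofactor is not inside P.\<close>
  have contains: "P \<in> S" if S: "S \<subseteq> {Q. 0 < e Q}" "finprod ideal_monoid ?f S \<subseteq> P" for S
  proof -
    have "ideal (?f Q) class_ring" if "Q \<in> S" for Q
      using that S(1) by (intro ideal_pow_closed id) auto
    then obtain Q where Q: "Q \<in> S" "?f Q \<subseteq> P"
      using finprod_ideal_subset_prime[OF P finite_subset[OF S(1) fin] _ S(2)] by blast
    have "0 < e Q"
      using Q(1) S(1) by auto
    have "primeideal Q class_ring" "Q \<noteq> {0}"
      using primes[OF \<open>0 < e Q\<close>] by auto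
    from nonzero_prime_eq[OF this P ideal_pow_subset_prime[OF P id[OF \<open>0 < e Q\<close>] Q(2)]]
    show ?thesis
      using Q(1) by simp
  qed
  have "PIdl\<^bsub>class_ring\<^esub> \<alpha> \<subseteq> P"
    using alpha by (auto simp: mem_cgenideal_class_ring elim!: dvdE intro: class_ideal_mult'[OF Pi])
  then have "P \<in> {Q. 0 < e Q}"
    using contains[of "{Q. 0 < e Q}"] fac by simp
  then have "0 < e P" by simp
  note split = prime_ideal_factorization_split[OF e this]
  let ?J = "finprod ideal_monoid ?f ({Q. 0 < e Q} - {P})"
  have "\<not> ?J \<subseteq> P"
    using contains[of "{Q. 0 < e Q} - {P}"] by auto
  then obtain \<beta> where beta: "\<beta> \<in> ?J" "\<beta> \<notin> P" by auto
  have "e P = 1" using eP \<open>0 < e P\<close> by simp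
  then have "PIdl\<^bsub>class_ring\<^esub> \<alpha> = P \<cdot>\<^bsub>class_ring\<^esub> ?J"
    using split(2) ideal_monoid.nat_pow_eone[of P] Pi by (simp only: ideal_monoid_simps mem_Collect_eq)
  then have "\<alpha> dvd p * \<beta>" if "p \<in> P" for p
    using mult_mem_ideal_prod[OF that beta(1)] mem_cgenideal_class_ring[of "p * \<beta>" \<alpha>] by simp
  then show ?thesis
    using beta(2) by (auto simp: mult.commute)
qed

text \<open>Any \<alpha> in P outside P^2 works, since an exponent of at least 2 would put \<alpha>
  into P^2. Such an \<alpha> exists because P = P^2 would give P both exponents 1 and 2.\<close>

lemma exists_local_uniformizer:
  assumes P: "primeideal P (class_ring :: 'r ring)" and P0: "P \<noteq> {0}"
  shows "\<exists>\<alpha> \<beta>. \<alpha> \<noteq> 0 \<and> \<alpha> \<in> P \<and> \<beta> \<notin> P \<and> (\<forall>p\<in>P. \<alpha> dvd \<beta> * p)"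
proof -
  have Pi: "ideal P class_ring" and Pn: "P \<noteq> UNIV"
    using P by (simp_all add: primeideal_class_ring_iff)
  let ?PP = "P \<cdot>\<^bsub>class_ring\<^esub> P"
  have "?PP \<subseteq> P"
    using ring.ideal_prod_inter[OF ring_class_ring Pi Pi] by auto
  moreover have "?PP \<noteq> P"
  proof
    assume eq: "?PP = P"
    let ?d = "\<lambda>Q. if Q = P then 1 else 0 :: nat"
    note d = prime_ideal_factorization_prime[OF P P0]
    have "?d = (\<lambda>Q. ?d Q + ?d Q)"
      using prime_ideal_factorization_mult[OF d d] unfolding eq
      by (rule prime_ideal_factorization_unique[OF Pi P0 Pn d])
    from fun_cong[OF this, of P] show False
      by simp
  qed
  ultimately obtain \<alpha> where alpha: "\<alpha> \<in> P" "\<alpha> \<notin> ?PP" by auto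
  have PPi: "ideal ?PP class_ring"
    by (rule ring.ideal_prod_is_ideal[OF ring_class_ring Pi Pi])
  have "\<alpha> \<noteq> 0" using alpha class_ideal_zero[OF PPi] by auto
  then have "PIdl\<^bsub>class_ring\<^esub> \<alpha> \<noteq> {0}"
    using mem_cgenideal_class_ring[of \<alpha> \<alpha>] by auto
  moreover have "ideal (PIdl\<^bsub>class_ring\<^esub> \<alpha>) class_ring"
    by (rule cring.cgenideal_ideal[OF cring_class_ring]) simp
  ultimately obtain e where e: "prime_ideal_factorization class_ring (PIdl\<^bsub>class_ring\<^esub> \<alpha>) e"
    using nonzero_ideal_factorization by metis
  have "e P \<le> 1"
  proof (rule ccontr)
    assume "\<not> e P \<le> 1"
    then obtain k where k: "e P = Suc (Suc k)"
      by (metis One_nat_def Suc_le_mono le0 not0_implies_Suc)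
    let ?Pk = "P [^]\<^bsub>ideal_monoid\<^esub> k"
    let ?J = "\<Otimes>\<^bsub>ideal_monoid\<^esub>Q\<in>{Q. 0 < e Q} - {P}. Q [^]\<^bsub>ideal_monoid\<^esub> e Q"
    have J: "ideal ?J class_ring" "PIdl\<^bsub>class_ring\<^esub> \<alpha> = (P [^]\<^bsub>ideal_monoid\<^esub> e P) \<cdot>\<^bsub>class_ring\<^esub> ?J"
      using prime_ideal_factorization_split[OF e, of P] k by auto
    have Pk: "ideal ?Pk class_ring"
      by (rule ideal_pow_closed[OF Pi])
    have "P [^]\<^bsub>ideal_monoid\<^esub> e P = ?Pk \<cdot>\<^bsub>class_ring\<^esub> P \<cdot>\<^bsub>class_ring\<^esub> P"
      using k by (simp add: ideal_monoid.nat_pow_Suc)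
    also have "\<dots> = ?Pk \<cdot>\<^bsub>class_ring\<^esub> ?PP"
      using ideal_monoid.m_assoc[of ?Pk P P] Pk Pi by simp
    also have "\<dots> \<subseteq> ?PP"
      using ring.ideal_prod_inter[OF ring_class_ring Pk PPi] by auto
    finally have "(P [^]\<^bsub>ideal_monoid\<^esub> e P) \<cdot>\<^bsub>class_ring\<^esub> ?J \<subseteq> ?PP"
      using ring.ideal_prod_inter[OF ring_class_ring ideal_pow_closed[OF Pi] J(1), of "e P"] by blast
    then show False
      using J(2) alpha mem_cgenideal_class_ring[of \<alpha> \<alpha>] by auto
  qed
  from simple_prime_factor_cofactor[OF P alpha(1) e this] alpha(1) \<open>\<alpha> \<noteq> 0\<close> show ?thesis
    by blast
qed

lemma exists_prime_superset:
  assumes I: "ideal I (class_ring :: 'r ring)" "I \<noteq> {0}" "I \<noteq> UNIV"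
  shows "\<exists>P. primeideal P class_ring \<and> P \<noteq> {0} \<and> I \<subseteq> P"
proof -
  obtain e where e: "prime_ideal_factorization class_ring I e"
    using nonzero_ideal_factorization[OF I(1,2)] .
  have "{Q. 0 < e Q} \<noteq> {}"
  proof
    assume em: "{Q. 0 < e Q} = {}"
    have "I = (\<Otimes>\<^bsub>ideal_monoid\<^esub>P\<in>{P. 0 < e P}. P [^]\<^bsub>ideal_monoid\<^esub> e P)"
      using e by (simp add: prime_ideal_factorization_def)
    then show False
      using I(3) unfolding em by simp
  qed
  then obtain P where eP: "0 < e P" by auto
  then obtain k where k: "e P = Suc k" using not0_implies_Suc by blast
  note split = prime_ideal_factorization_split[OF e eP]
  have P: "primeideal P class_ring" "P \<noteq> {0}"
    using e eP by (auto simp: prime_ideal_factorization_def)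
  then have Pi: "ideal P class_ring" by (simp add: primeideal_def)
  have "I \<subseteq> P [^]\<^bsub>ideal_monoid\<^esub> e P"
    using split(2) ring.ideal_prod_inter[OF ring_class_ring ideal_pow_closed[OF Pi] split(1), of "e P"] by blast
  also have "\<dots> \<subseteq> P"
    using ring.ideal_prod_inter[OF ring_class_ring ideal_pow_closed[OF Pi, of k] Pi]
    by (simp add: k ideal_monoid.nat_pow_Suc)
  finally show ?thesis
    using P by blast
qed

end

section \<open>Determinants and polynomials of matrices\<close>

text \<open>In the Leibniz expansion a permutation fixing i contributes the entry at (i,i). Any
  other one contributes an off-diagonal entry of row i and another of column i, whose product lies
  in N.\<close>

lemma det_in_ideal:
  assumes I: "ideal I class_ring" and N: "ideal N class_ring"
    and IN: "\<And>x y. x \<in> I \<Longrightarrow> y \<in> I \<Longrightarrow> x * y \<in> N"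
    and B: "B \<in> carrier_mat n n" and i: "i < n"
    and Bii: "B $$ (i,i) \<in> N"
    and row: "\<And>j. j < n \<Longrightarrow> j \<noteq> i \<Longrightarrow> B $$ (i,j) \<in> I"
    and col: "\<And>j. j < n \<Longrightarrow> j \<noteq> i \<Longrightarrow> B $$ (j,i) \<in> I"
  shows "det B \<in> N"
  unfolding det_def'[OF B]
proof (intro class_ideal_sum[OF N] class_ideal_mult[OF N])
  fix p assume "p \<in> {p. p permutes {0..<n}}"
  then have p: "p permutes {0..<n}" by simp
  show "(\<Prod>k = 0..<n. B $$ (k, p k)) \<in> N"
  proof (cases "p i = i")
    case True
    then show ?thesis
      using i Bii by (intro class_ideal_prod[OF N, where i = i]) auto
  next
    case False
    obtain j where j: "p j = i"
      using permutes_surj[OF p] by (metis surjD)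
    have jn: "j < n"
      using permutes_in_image[OF p, of j] i j by simp
    have pi: "p i < n"
      using permutes_in_image[OF p, of i] i by simp
    have ji: "j \<noteq> i" using False j by auto
    have "(\<Prod>k = 0..<n. B $$ (k, p k)) =
        (B $$ (i, p i) * B $$ (j, i)) * (\<Prod>k \<in> {0..<n} - {i} - {j}. B $$ (k, p k))"
      using i jn ji j
      by (subst prod.remove[of _ i], simp, simp, subst prod.remove[of _ j], auto)
    also have "\<dots> \<in> N"
      using row[OF pi] col[OF jn] False ji by (intro class_ideal_mult'[OF N] IN) auto
    finally show ?thesis .
  qed
qed

text \<open>Multiplying \<open>A\<close> on both sides by the identity matrix whose \<open>i\<close>-th column is
  replaced by \<open>v\<close> puts \<open>v \<bullet> A v\<close> at the position \<open>(i,i)\<close>.\<close>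

lemma symmetric_det_in_ideal:
  assumes I: "ideal I class_ring" and N: "ideal N class_ring"
    and IN: "\<And>x y. x \<in> I \<Longrightarrow> y \<in> I \<Longrightarrow> x * y \<in> N"
    and A: "A \<in> carrier_mat n n" and sym: "transpose_mat A = A" and v: "v \<in> carrier_vec n"
    and Av: "\<And>j. j < n \<Longrightarrow> (A *\<^sub>v v) $ j \<in> I" and vAv: "v \<bullet> (A *\<^sub>v v) \<in> N"
    and i: "i < n"
  shows "(v $ i)\<^sup>2 * det A \<in> N"
proof -
  \<comment> \<open>With E the modified identity matrix, B is E^T A by symmetry of A, and C is E^T A
    E. Each multiplication by E contributes a factor \<open>v $ i\<close> to the
    determinant.\<close>
  define B where "B = transpose_mat (replace_col A (A *\<^sub>v v) i)"
  define C where "C = replace_col B (B *\<^sub>v v) i"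
  have B: "B \<in> carrier_mat n n"
    using A by (auto simp: B_def replace_col_def)
  have C: "C \<in> carrier_mat n n"
    using B by (auto simp: C_def replace_col_def)
  have "det C = v $ i * det B"
    unfolding C_def by (rule cramer_lemma_mat[OF B v i])
  also have "det B = v $ i * det A"
    unfolding B_def using B by (subst det_transpose[of _ n]) (auto simp: B_def cramer_lemma_mat[OF A v i])
  finally have "det C = (v $ i)\<^sup>2 * det A"
    by (simp add: power2_eq_square mult.assoc)
  moreover have Bv: "(B *\<^sub>v v) $ j = (if j = i then v \<bullet> (A *\<^sub>v v) else (A *\<^sub>v v) $ j)" if "j < n" for j
  proof (cases "j = i")
    case True
    have "row B i = A *\<^sub>v v"
      using A i by (auto simp: B_def replace_col_def)
    then show ?thesis
      using True that B v A by (auto simp: comm_scalar_prod[of _ n])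
  next
    case False
    have "row B j = col A j"
      using A False that by (auto simp: B_def replace_col_def)
    also have "\<dots> = row A j"
      using A that by (subst (2) sym[symmetric]) auto
    finally show ?thesis
      using False that B v A by auto
  qed
  moreover have "det C \<in> N"
  proof (rule det_in_ideal[OF I N IN C i])
    show "C $$ (i,i) \<in> N"
      using B i Bv[OF i] vAv by (simp add: C_def replace_col_def)
    fix j assume j: "j < n" "j \<noteq> i"
    show "C $$ (j,i) \<in> I"
      using B i Bv[OF j(1)] j Av[of j] by (simp add: C_def replace_col_def)
    have "C $$ (i,j) = (A *\<^sub>v v) $ j"
      using A B i j v by (simp add: C_def B_def replace_col_def)
    then show "C $$ (i,j) \<in> I"
      using Av[OF j(1)] by simp
  qed
  ultimately show ?thesis by simp
qed

section \<open>Evaluating polynomials at a square matrix\<close>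

lemma poly_mat_carrier:
  "A \<in> carrier_mat n n \<Longrightarrow> poly_mat p A \<in> carrier_mat n n"
  by (auto simp: poly_mat_def)

lemma poly_mat_dim [simp]:
  "dim_row (poly_mat p A) = dim_row A" "dim_col (poly_mat p A) = dim_row A"
  by (auto simp: poly_mat_def)

lemma poly_mat_index:
  assumes "A \<in> carrier_mat n n" "i < n" "j < n" "degree p \<le> d"
  shows "poly_mat p A $$ (i,j) = (\<Sum>k\<le>d. poly.coeff p k * (A ^\<^sub>m k) $$ (i,j))"
proof -
  have "(\<Sum>k\<le>degree p. poly.coeff p k * (A ^\<^sub>m k) $$ (i,j)) = (\<Sum>k\<le>d. poly.coeff p k * (A ^\<^sub>m k) $$ (i,j))"
    using assms(4) by (intro sum.mono_neutral_left) (auto simp: coeff_eq_0)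
  then show ?thesis
    using assms by (simp add: poly_mat_def)
qed

lemma poly_mat_0 [simp]: "A \<in> carrier_mat n n \<Longrightarrow> poly_mat 0 A = 0\<^sub>m n n"
  by (auto simp: poly_mat_def intro!: eq_matI)

lemma poly_mat_add:
  assumes "A \<in> carrier_mat n n"
  shows "poly_mat (p + q) A = poly_mat p A + poly_mat q A"
proof (rule eq_matI)
  let ?d = "max (degree p) (degree q)"
  fix i j assume "i < dim_row (poly_mat p A + poly_mat q A)" "j < dim_col (poly_mat p A + poly_mat q A)"
  then have ij: "i < n" "j < n" using assms by auto
  show "poly_mat (p + q) A $$ (i,j) = (poly_mat p A + poly_mat q A) $$ (i,j)"
    using ij assms degree_add_le_max[of p q]
    by (simp add: poly_mat_index[of _ n _ _ _ ?d] sum.distrib distrib_right)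
qed (use assms in auto)

lemma poly_mat_smult:
  assumes "A \<in> carrier_mat n n"
  shows "poly_mat (Polynomial.smult a p) A = a \<cdot>\<^sub>m poly_mat p A"
  using assms degree_smult_le[of a p]
  by (auto intro!: eq_matI simp: poly_mat_index[of _ n _ _ _ "degree p"] sum_distrib_left mult.assoc)

lemma poly_mat_pCons:
  assumes A: "A \<in> carrier_mat n n"
  shows "poly_mat (pCons a p) A = a \<cdot>\<^sub>m 1\<^sub>m n + poly_mat p A * A"
proof (rule eq_matI)
  fix i j assume "i < dim_row (a \<cdot>\<^sub>m 1\<^sub>m n + poly_mat p A * A)" "j < dim_col (a \<cdot>\<^sub>m 1\<^sub>m n + poly_mat p A * A)"
  then have ij: "i < n" "j < n" using A by auto
  have pow: "A ^\<^sub>m k \<in> carrier_mat n n" for k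
    using A by simp
  have "(poly_mat p A * A) $$ (i,j) = (\<Sum>l<n. (\<Sum>k\<le>degree p. poly.coeff p k * (A ^\<^sub>m k) $$ (i,l)) * A $$ (l,j))"
    using A ij by (simp add: scalar_prod_def poly_mat_index[OF A _ _ order.refl] lessThan_atLeast0)
  also have "\<dots> = (\<Sum>k\<le>degree p. poly.coeff p k * (\<Sum>l<n. (A ^\<^sub>m k) $$ (i,l) * A $$ (l,j)))"
    unfolding sum_distrib_right sum_distrib_left by (subst sum.swap) (simp add: mult.assoc)
  also have "\<dots> = (\<Sum>k\<le>degree p. poly.coeff p k * (A ^\<^sub>m Suc k) $$ (i,j))"
    using A ij pow by (intro sum.cong refl) (simp add: scalar_prod_def lessThan_atLeast0 carrier_matD[OF pow])
  finally have "(poly_mat p A * A) $$ (i,j) = (\<Sum>k\<le>degree p. poly.coeff p k * (A ^\<^sub>m Suc k) $$ (i,j))" .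
  moreover have "poly_mat (pCons a p) A $$ (i,j) =
      (\<Sum>k\<le>Suc (degree p). poly.coeff (pCons a p) k * (A ^\<^sub>m k) $$ (i,j))"
    using ij degree_pCons_le by (intro poly_mat_index[OF A]) auto
  ultimately show "poly_mat (pCons a p) A $$ (i,j) = (a \<cdot>\<^sub>m 1\<^sub>m n + poly_mat p A * A) $$ (i,j)"
    using A ij by (simp add: sum.atMost_Suc_shift del: sum.atMost_Suc pow_mat.simps(2))
qed (use A in auto)

lemma poly_mat_commute:
  assumes A: "A \<in> carrier_mat n n"
  shows "poly_mat p A * A = A * poly_mat p A"
proof (induction p)
  case (pCons a p)
  note P = poly_mat_carrier[OF A, of p]
  have PA: "poly_mat p A * A \<in> carrier_mat n n" using A P by simp
  have "poly_mat (pCons a p) A * A = a \<cdot>\<^sub>m A + poly_mat p A * A * A"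
    using A by (simp add: poly_mat_pCons[OF A] add_mult_distrib_mat[OF _ PA A] mult_smult_assoc_mat[OF one_carrier_mat A])
  also have "\<dots> = a \<cdot>\<^sub>m A + A * (poly_mat p A * A)"
    using A P by (simp add: pCons assoc_mult_mat[OF A P A])
  also have "\<dots> = A * poly_mat (pCons a p) A"
    using A P PA by (simp add: poly_mat_pCons[OF A] mult_add_distrib_mat[OF A _ PA] mult_smult_distrib[OF A, of _ n])
  finally show ?case .
qed (use A in simp)

lemma poly_mat_mult:
  assumes A: "A \<in> carrier_mat n n"
  shows "poly_mat (p * q) A = poly_mat p A * poly_mat q A"
proof (induction p)
  case (pCons a p)
  note P = poly_mat_carrier[OF A, of p] and Q = poly_mat_carrier[OF A, of q]
  have PA: "poly_mat p A * A \<in> carrier_mat n n" and PQ: "poly_mat p A * poly_mat q A * A \<in> carrier_mat n n"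
    using A P Q by simp_all
  have "0 \<cdot>\<^sub>m 1\<^sub>m n + poly_mat p A * poly_mat q A * A = poly_mat p A * poly_mat q A * A"
    using PQ by (intro eq_matI) (auto simp: carrier_matD[OF A])
  then have "poly_mat (pCons a p * q) A = a \<cdot>\<^sub>m poly_mat q A + poly_mat p A * poly_mat q A * A"
    by (simp add: pCons poly_mat_add[OF A] poly_mat_smult[OF A] poly_mat_pCons[OF A])
  also have "\<dots> = a \<cdot>\<^sub>m poly_mat q A + poly_mat p A * A * poly_mat q A"
    by (simp add: assoc_mult_mat[OF P Q A] assoc_mult_mat[OF P A Q] poly_mat_commute[OF A, of q])
  also have "\<dots> = (a \<cdot>\<^sub>m 1\<^sub>m n + poly_mat p A * A) * poly_mat q A"
    using Q by (simp add: add_mult_distrib_mat[OF _ PA Q] mult_smult_assoc_mat[OF one_carrier_mat Q] left_mult_one_mat[OF Q])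
  finally show ?case by (simp add: poly_mat_pCons[OF A])
qed (use A poly_mat_carrier[OF A, of q] in simp)

lemma poly_mat_symmetric:
  assumes A: "A \<in> carrier_mat n n" and sym: "transpose_mat A = A"
  shows "transpose_mat (poly_mat p A) = poly_mat p A"
proof (induction p)
  case (pCons a p)
  note P = poly_mat_carrier[OF A, of p]
  have PA: "poly_mat p A * A \<in> carrier_mat n n" using A P by simp
  have "transpose_mat (poly_mat (pCons a p) A) = transpose_mat (a \<cdot>\<^sub>m 1\<^sub>m n) + A * poly_mat p A"
    by (simp add: pCons poly_mat_pCons[OF A] transpose_add[OF _ PA] transpose_mult[OF P A] sym)
  also have "transpose_mat (a \<cdot>\<^sub>m 1\<^sub>m n) = a \<cdot>\<^sub>m 1\<^sub>m n"
    by (auto intro!: eq_matI)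
  finally show ?case by (simp add: poly_mat_pCons[OF A] poly_mat_commute[OF A])
qed (use A in simp)

text \<open>This makes the image of M stable under all polynomials in X: p acts through X on the
  image and through Y on the coordinates.\<close>

lemma poly_mat_intertwine:
  assumes X: "X \<in> carrier_mat n n" and Y: "Y \<in> carrier_mat m m" and M: "M \<in> carrier_mat n m"
    and XM: "X * M = M * Y"
  shows "poly_mat p X * M = M * poly_mat p Y"
proof (induction p)
  case (pCons a p)
  note PX = poly_mat_carrier[OF X, of p] and PY = poly_mat_carrier[OF Y, of p]
  have PXX: "poly_mat p X * X \<in> carrier_mat n n" and PYY: "poly_mat p Y * Y \<in> carrier_mat m m"
    using X Y PX PY by simp_all
  have "poly_mat (pCons a p) X * M = a \<cdot>\<^sub>m M + poly_mat p X * (X * M)"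
    using M by (simp add: poly_mat_pCons[OF X] add_mult_distrib_mat[OF _ PXX M] mult_smult_assoc_mat[OF one_carrier_mat M] assoc_mult_mat[OF PX X M])
  also have "poly_mat p X * (X * M) = M * (poly_mat p Y * Y)"
    by (simp add: pCons XM flip: assoc_mult_mat[OF PX M Y] assoc_mult_mat[OF M PY Y])
  also have "a \<cdot>\<^sub>m M + M * (poly_mat p Y * Y) = M * poly_mat (pCons a p) Y"
    using M by (simp add: poly_mat_pCons[OF Y] mult_add_distrib_mat[OF M _ PYY] mult_smult_distrib[OF M, of _ m])
  finally show ?case .
qed (use assms in simp)

lemma mult_mat_vec_pCons:
  assumes A: "A \<in> carrier_mat n n" and v: "v \<in> carrier_vec n" and i: "i < n"
  shows "(poly_mat (pCons a p) A *\<^sub>v v) $ i = a * v $ i + (A *\<^sub>v (poly_mat p A *\<^sub>v v)) $ i"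
proof -
  note P = poly_mat_carrier[OF A, of p]
  have AP: "A * poly_mat p A \<in> carrier_mat n n" using A P by simp
  have "poly_mat (pCons a p) A *\<^sub>v v = (a \<cdot>\<^sub>m 1\<^sub>m n) *\<^sub>v v + A *\<^sub>v (poly_mat p A *\<^sub>v v)"
    using v by (simp add: poly_mat_pCons[OF A] poly_mat_commute[OF A]
        add_mult_distrib_mat_vec[OF _ AP v] assoc_mult_mat_vec[OF A P v])
  moreover have "((a \<cdot>\<^sub>m 1\<^sub>m n) *\<^sub>v v) $ i = a * v $ i"
    using v i by simp
  ultimately show ?thesis
    using i A P v by simp
qed

lemma poly_mat_mult_vec:
  assumes A: "A \<in> carrier_mat n n" and v: "v \<in> carrier_vec n"
  shows "poly_mat (p * q) A *\<^sub>v v = poly_mat p A *\<^sub>v (poly_mat q A *\<^sub>v v)"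
  by (simp add: poly_mat_mult[OF A] assoc_mult_mat_vec[OF poly_mat_carrier[OF A] poly_mat_carrier[OF A] v])

lemma poly_mat_add_vec:
  assumes A: "A \<in> carrier_mat n n" and v: "v \<in> carrier_vec n"
  shows "poly_mat (p + q) A *\<^sub>v v = poly_mat p A *\<^sub>v v + poly_mat q A *\<^sub>v v"
  by (simp add: poly_mat_add[OF A] add_mult_distrib_mat_vec[OF poly_mat_carrier[OF A] poly_mat_carrier[OF A] v])

section \<open>The matrix x - X and division of g(x) - g(X) by it\<close>

lemma char_poly_matrix_mult_vec_index:
  assumes X: "X \<in> carrier_mat n n" and u: "u \<in> carrier_vec n" and i: "i < n"
  shows "(char_poly_matrix X *\<^sub>v u) $ i = pCons 0 (u $ i) - (\<Sum>j<n. Polynomial.smult (X $$ (i,j)) (u $ j))"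
proof -
  have "(char_poly_matrix X *\<^sub>v u) $ i = (\<Sum>j<n. char_poly_matrix X $$ (i,j) * u $ j)"
    using u i carrier_matD[OF char_poly_matrix_closed[OF X]] by (simp add: scalar_prod_def lessThan_atLeast0)
  also have "\<dots> = (\<Sum>j<n. (if j = i then pCons 0 (u $ i) else 0) - Polynomial.smult (X $$ (i,j)) (u $ j))"
    using assms by (intro sum.cong refl) (auto simp: char_poly_matrix_def)
  finally show ?thesis
    using i by (simp add: sum_subtractf)
qed

lemma char_poly_matrix_symmetric:
  assumes "X \<in> carrier_mat n n" "transpose_mat X = X"
  shows "transpose_mat (char_poly_matrix X) = char_poly_matrix X"
proof (rule eq_matI)
  fix i j assume ij: "i < dim_row (char_poly_matrix X)" "j < dim_col (char_poly_matrix X)"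
  have "X $$ (j,i) = X $$ (i,j)"
    using ij assms carrier_matD[OF char_poly_matrix_closed[OF assms(1)]]
    by (metis carrier_matD index_transpose_mat(1))
  then show "transpose_mat (char_poly_matrix X) $$ (i,j) = char_poly_matrix X $$ (i,j)"
    using ij assms by (auto simp: char_poly_matrix_def)
qed (use assms in \<open>auto simp: char_poly_matrix_def\<close>)

text \<open>One Horner step: \<open>poly_shift k p\<close> is the partial Horner polynomial formed
  from the coefficients of p at index k and above.\<close>

lemma pCons_poly_shift: "poly_shift k p = pCons (poly.coeff p k) (poly_shift (Suc k) p)"
  by (rule poly_eqI) (auto simp: coeff_poly_shift coeff_pCons split: nat.split)

lemma poly_shift_eq_0: "degree p < k \<Longrightarrow> poly_shift k p = 0"
  by (rule poly_eqI) (auto simp: coeff_poly_shift coeff_eq_0)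

text \<open>The vector of polynomials \<open>H v\<close>, where \<open>H\<close> is the quotient of \<open>g(x) - g(X)\<close>
  by \<open>x - X\<close>.\<close>

definition poly_quot_vec :: "'a::comm_ring_1 poly \<Rightarrow> 'a mat \<Rightarrow> 'a vec \<Rightarrow> 'a poly vec" where
  "poly_quot_vec g X v = vec (dim_row X)
     (\<lambda>i. \<Sum>k<degree g. Polynomial.monom ((poly_mat (poly_shift (Suc k) g) X *\<^sub>v v) $ i) k)"

lemma poly_quot_vec_carrier: "X \<in> carrier_mat n n \<Longrightarrow> poly_quot_vec g X v \<in> carrier_vec n"
  by (simp add: poly_quot_vec_def)

text \<open>The defining sum stops below \<open>degree g\<close>, but the shifted polynomials vanish
  from there on, so the formula covers every k. For monic nonconstant g the top coefficient vector
  is v.\<close>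

lemma coeff_poly_quot_vec:
  assumes X: "X \<in> carrier_mat n n" and v: "v \<in> carrier_vec n" and i: "i < n"
  shows "poly.coeff (poly_quot_vec g X v $ i) k = (poly_mat (poly_shift (Suc k) g) X *\<^sub>v v) $ i"
proof -
  have "(poly_mat (poly_shift (Suc k) g) X *\<^sub>v v) $ i = 0" if "\<not> k < degree g"
    using that X v i by (simp add: poly_shift_eq_0)
  then show ?thesis
    using X i by (auto simp: poly_quot_vec_def coeff_sum)
qed

text \<open>The Horner scheme telescopes: in degree k the product has the k-th Horner vector minus X
  times the next one, which is the k-th coefficient of g times v. In degree 0 the Horner vector g(X)
  v is missing, which gives the correction.\<close>

lemma char_poly_matrix_mult_poly_quot_vec:
  assumes X: "X \<in> carrier_mat n n" and v: "v \<in> carrier_vec n" and i: "i < n"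
  shows "(char_poly_matrix X *\<^sub>v poly_quot_vec g X v) $ i =
    Polynomial.smult (v $ i) g - [:(poly_mat g X *\<^sub>v v) $ i:]"
proof (rule poly_eqI)
  fix k
  define W where "W k = poly_mat (poly_shift k g) X *\<^sub>v v" for k
  have Wc: "W k \<in> carrier_vec n" for k
    unfolding W_def by (rule mult_mat_vec_carrier[OF poly_mat_carrier[OF X] v])
  have W: "W k $ i = poly.coeff g k * v $ i + (\<Sum>j<n. X $$ (i,j) * W (Suc k) $ j)" for k
  proof -
    have "W k $ i = poly.coeff g k * v $ i + (X *\<^sub>v W (Suc k)) $ i"
      unfolding W_def by (subst pCons_poly_shift) (rule mult_mat_vec_pCons[OF X v i])
    then show ?thesis
      using X i Wc[of "Suc k"] by (simp add: scalar_prod_def lessThan_atLeast0)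
  qed
  have u: "poly.coeff (poly_quot_vec g X v $ j) k = W (Suc k) $ j" if "j < n" for j k
    using coeff_poly_quot_vec[OF X v that] by (simp add: W_def)
  have "poly.coeff ((char_poly_matrix X *\<^sub>v poly_quot_vec g X v) $ i) k =
      (case k of 0 \<Rightarrow> 0 | Suc k' \<Rightarrow> W (Suc k') $ i) - (\<Sum>j<n. X $$ (i,j) * W (Suc k) $ j)"
    using i u by (simp add: char_poly_matrix_mult_vec_index[OF X poly_quot_vec_carrier[OF X] i]
        coeff_sum coeff_pCons split: nat.split)
  also have "\<dots> = poly.coeff (Polynomial.smult (v $ i) g - [:W 0 $ i:]) k"
    using W[of k] by (auto simp: coeff_pCons mult.commute split: nat.split)
  also have "W 0 = poly_mat g X *\<^sub>v v"
    by (simp add: W_def)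
  finally show "poly.coeff ((char_poly_matrix X *\<^sub>v poly_quot_vec g X v) $ i) k =
      poly.coeff (Polynomial.smult (v $ i) g - [:(poly_mat g X *\<^sub>v v) $ i:]) k" .
qed

text \<open>The coefficient vectors of a vector \<open>w\<close> with \<open>(x - X) w = g v\<close> satisfy the recursion of
  the Horner scheme for \<open>g(X) v\<close>; they agree with it from the top down.\<close>

lemma poly_mat_mult_vec_eq_0:
  assumes X: "X \<in> carrier_mat n n" and v: "v \<in> carrier_vec n" and w: "w \<in> carrier_vec n"
    and eq: "\<And>i. i < n \<Longrightarrow> (char_poly_matrix X *\<^sub>v w) $ i = Polynomial.smult (v $ i) g"
  shows "poly_mat g X *\<^sub>v v = 0\<^sub>v n"
proof -
  define b where "b k = vec n (\<lambda>i. poly.coeff (w $ i) k)" for k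
  define W where "W k = poly_mat (poly_shift k g) X *\<^sub>v v" for k
  have Wc: "W k \<in> carrier_vec n" for k
    unfolding W_def by (rule mult_mat_vec_carrier[OF poly_mat_carrier[OF X] v])
  have bc: "b k \<in> carrier_vec n" for k
    by (simp add: b_def)
  have W: "W k $ i = poly.coeff g k * v $ i + (X *\<^sub>v W (Suc k)) $ i" if "i < n" for i k
    unfolding W_def by (subst pCons_poly_shift) (rule mult_mat_vec_pCons[OF X v that])
  have b: "poly.coeff g k * v $ i = (case k of 0 \<Rightarrow> 0 | Suc k' \<Rightarrow> b k' $ i) - (X *\<^sub>v b k) $ i" if "i < n" for i k
  proof -
    have "poly.coeff g k * v $ i = poly.coeff ((char_poly_matrix X *\<^sub>v w) $ i) k"
      by (simp add: eq[OF that] mult.commute)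
    also have "\<dots> = (case k of 0 \<Rightarrow> 0 | Suc k' \<Rightarrow> b k' $ i) - (\<Sum>j<n. X $$ (i,j) * b k $ j)"
      using that by (simp add: char_poly_matrix_mult_vec_index[OF X w that] b_def coeff_sum coeff_pCons split: nat.split)
    finally show ?thesis
      using that X bc[of k] by (simp add: scalar_prod_def lessThan_atLeast0)
  qed
  \<comment> \<open>Beyond N both families vanish. The induction on m runs downwards in k: the
    equations in degree k + 1 determine \<open>b k\<close> and \<open>W (Suc k)\<close> from the
    next terms.\<close>
  define N where "N = degree g + (\<Sum>i<n. degree (w $ i))"
  have "b k = W (Suc k)" if "k + m > N" for k m
    using that
  proof (induction m arbitrary: k)
    case 0
    have "b k $ i = 0" if "i < n" for i
    proof -
      have "degree (w $ i) \<le> (\<Sum>i<n. degree (w $ i))"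
        using that by (intro member_le_sum) auto
      then show ?thesis
        using 0 that by (simp add: b_def N_def coeff_eq_0)
    qed
    moreover have "W (Suc k) = 0\<^sub>v n"
      using 0 X v by (auto simp: W_def N_def poly_shift_eq_0)
    ultimately show ?case
      by (auto simp: b_def)
  next
    case (Suc m)
    then have IH: "b (Suc k) = W (Suc (Suc k))"
      by simp
    show ?case
    proof (rule eq_vecI)
      fix i assume "i < dim_vec (W (Suc k))"
      then have i: "i < n" using Wc[of "Suc k"] by simp
      show "b k $ i = W (Suc k) $ i"
        using W[OF i, of "Suc k"] b[OF i, of "Suc k"] IH by simp
    qed (use Wc bc in \<open>simp add: carrier_vecD[of _ n]\<close>)
  qed
  then have b0: "b 0 = W 1"
    by (metis One_nat_def add_0 lessI)
  have "W 0 = 0\<^sub>v n"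
  proof (rule eq_vecI)
    fix i assume "i < dim_vec (0\<^sub>v n :: 'a vec)"
    then have i: "i < n" by simp
    show "W 0 $ i = 0\<^sub>v n $ i"
      using W[OF i, of 0] b[OF i, of 0] i b0 by simp
  qed (use Wc in \<open>simp add: carrier_vecD[of _ n]\<close>)
  then show ?thesis
    by (simp add: W_def)
qed

text \<open>The adjugate of x - X applied to v is a vector that x - X maps to the characteristic
  polynomial times v.\<close>

lemma Cayley_Hamilton_vec:
  assumes X: "X \<in> carrier_mat n n" and v: "v \<in> carrier_vec n"
  shows "poly_mat (char_poly X) X *\<^sub>v v = 0\<^sub>v n"
proof (rule poly_mat_mult_vec_eq_0[OF X v])
  let ?A = "char_poly_matrix X" and ?v = "map_vec (\<lambda>a. [:a:]) v"
  have A: "?A \<in> carrier_mat n n" using X by simp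
  note adj = adj_mat[OF A]
  have vc: "?v \<in> carrier_vec n" using v by simp
  show "adj_mat ?A *\<^sub>v ?v \<in> carrier_vec n"
    using adj(1) vc by simp
  fix i assume i: "i < n"
  have "?A *\<^sub>v (adj_mat ?A *\<^sub>v ?v) = (det ?A \<cdot>\<^sub>m 1\<^sub>m n) *\<^sub>v ?v"
    by (simp only: assoc_mult_mat_vec[OF A adj(1) vc, symmetric] adj(2))
  then show "(?A *\<^sub>v (adj_mat ?A *\<^sub>v ?v)) $ i = Polynomial.smult (v $ i) (char_poly X)"
    using i v by (simp add: char_poly_def)
qed

section \<open>Matrices with isotropic image modulo a prime\<close>

text \<open>This is the ideal P R[x], described by coefficients.\<close>

lemma ideal_coeffs_in:
  assumes P: "ideal P (class_ring :: 'a::comm_ring_1 ring)"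
  shows "ideal {f. \<forall>k. poly.coeff f k \<in> P} class_ring"
  unfolding ideal_class_ring_iff
proof (intro conjI ballI allI)
  show "0 \<in> {f. \<forall>k. poly.coeff f k \<in> P}"
    using class_ideal_zero[OF P] by simp
  fix f g :: "'a poly" assume f: "f \<in> {f. \<forall>k. poly.coeff f k \<in> P}"
  show "g * f \<in> {f. \<forall>k. poly.coeff f k \<in> P}"
    using f by (auto simp: coeff_mult intro!: class_ideal_sum[OF P] class_ideal_mult[OF P])
  assume "g \<in> {f. \<forall>k. poly.coeff f k \<in> P}"
  then show "f + g \<in> {f. \<forall>k. poly.coeff f k \<in> P}"
    using f by (auto intro: class_ideal_add[OF P])
qed

text \<open>\<open>unit\<close> says that R/P is a field. The product
  \<open>transpose_mat M * M\<close> is constrained only modulo P here; the finer information modulo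
  P^2 enters after the vector v has been found.\<close>

locale isotropic_image =
  fixes P :: "'r::idom set" and n :: nat and X Y M :: "'r mat"
  assumes prime: "primeideal P class_ring"
    and unit: "a \<notin> P \<Longrightarrow> \<exists>b. a * b - 1 \<in> P"
    and X: "X \<in> carrier_mat n n" and sym: "transpose_mat X = X"
    and Y: "Y \<in> carrier_mat n n" and M: "M \<in> carrier_mat n n"
    and XM: "X * M = M * Y"
    and MM: "i < n \<Longrightarrow> j < n \<Longrightarrow> (transpose_mat M * M) $$ (i,j) \<in> P"
    and M_notin: "\<exists>i<n. \<exists>j<n. M $$ (i,j) \<notin> P"
begin

lemma P: "ideal P class_ring"
  using prime unfolding primeideal_class_ring_iff by simp

text \<open>The image is taken over R rather than modulo P, so that scalar products of its elements
  can also be tested against a smaller ideal.\<close>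

definition V :: "'r vec set" where
  "V = {v. \<exists>c \<in> carrier_vec n. v = M *\<^sub>v c}"

definition null :: "'r vec \<Rightarrow> bool" where
  "null v \<longleftrightarrow> (\<forall>i<n. v $ i \<in> P)"

text \<open>For vectors of length n this is an ideal of R[x] containing P R[x]; it stands in for the
  annihilator among polynomials over the residue field. The ideal m is \<open>ann v\<close> for a
  suitable v.\<close>

definition ann :: "'r vec \<Rightarrow> 'r poly set" where
  "ann v = {f. null (poly_mat f X *\<^sub>v v)}"

lemma V_carrier: "v \<in> V \<Longrightarrow> v \<in> carrier_vec n"
  using M by (auto simp: V_def)

lemma poly_mat_V:
  assumes "v \<in> V"
  shows "poly_mat f X *\<^sub>v v \<in> V"
proof -
  obtain c where c: "c \<in> carrier_vec n" "v = M *\<^sub>v c"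
    using assms by (auto simp: V_def)
  note FX = poly_mat_carrier[OF X, of f] and FY = poly_mat_carrier[OF Y, of f]
  have "poly_mat f X *\<^sub>v v = M *\<^sub>v (poly_mat f Y *\<^sub>v c)"
    using c by (simp add: assoc_mult_mat_vec[OF FX M, symmetric] assoc_mult_mat_vec[OF M FY, symmetric]
        poly_mat_intertwine[OF X Y M XM])
  then show ?thesis
    using FY c mult_mat_vec_carrier[OF FY c(1)] by (auto simp: V_def)
qed

text \<open>(M c) . (M d) = c . (M^T M) d. The ideal is a parameter because isotropy uses P, while
  the corner entry of phi'(X) uses a counterpart of P^2.\<close>

lemma V_scalar_prod_in:
  assumes I: "ideal I class_ring"
    and MI: "\<And>i j. i < n \<Longrightarrow> j < n \<Longrightarrow> (transpose_mat M * M) $$ (i,j) \<in> I"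
    and "v \<in> V" "w \<in> V"
  shows "v \<bullet> w \<in> I"
proof -
  obtain c where c: "c \<in> carrier_vec n" "v = M *\<^sub>v c"
    using assms(3) by (auto simp: V_def)
  obtain d where d: "d \<in> carrier_vec n" "w = M *\<^sub>v d"
    using assms(4) by (auto simp: V_def)
  note wc = V_carrier[OF assms(4)]
  have MT: "transpose_mat M \<in> carrier_mat n n" using M by simp
  have MMc: "transpose_mat M * M \<in> carrier_mat n n" using M by simp
  have "v \<bullet> w = c \<bullet> (transpose_mat M *\<^sub>v w)"
    using transpose_vec_mult_scalar[OF M c(1) wc] c V_carrier[OF assms(3)]
      mult_mat_vec_carrier[OF MT wc] wc
    by (metis comm_scalar_prod)
  also have "\<dots> = c \<bullet> ((transpose_mat M * M) *\<^sub>v d)"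
    unfolding d(2) by (simp add: assoc_mult_mat_vec[OF MT M d(1)])
  also have "\<dots> \<in> I"
  proof (rule class_ideal_scalar_prod[OF I])
    show "dim_vec ((transpose_mat M * M) *\<^sub>v d) = n" using M by simp
    fix i assume i: "i < n"
    show "((transpose_mat M * M) *\<^sub>v d) $ i \<in> I"
      by (rule class_ideal_mult_mat_vec[OF I MMc d(1) i MI[OF i]])
  qed
  finally show ?thesis .
qed

lemma isotropic: "v \<in> V \<Longrightarrow> w \<in> V \<Longrightarrow> v \<bullet> w \<in> P"
  by (rule V_scalar_prod_in[OF P MM])

lemma null_mult: "A \<in> carrier_mat n n \<Longrightarrow> v \<in> carrier_vec n \<Longrightarrow> null v \<Longrightarrow> null (A *\<^sub>v v)"
  unfolding null_def by (auto intro!: class_ideal_scalar_prod[OF P])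

lemma ann_mult_iff: "v \<in> carrier_vec n \<Longrightarrow> f * h \<in> ann v \<longleftrightarrow> f \<in> ann (poly_mat h X *\<^sub>v v)"
  by (simp add: ann_def poly_mat_mult_vec[OF X])

lemma ideal_ann:
  assumes v: "v \<in> carrier_vec n"
  shows "ideal (ann v) class_ring"
  unfolding ideal_class_ring_iff
proof (intro conjI ballI allI)
  show "0 \<in> ann v"
    using X v class_ideal_zero[OF P] by (simp add: ann_def null_def)
  have c: "poly_mat f X *\<^sub>v v \<in> carrier_vec n" for f
    by (rule mult_mat_vec_carrier[OF poly_mat_carrier[OF X] v])
  fix f g assume f: "f \<in> ann v"
  show "g * f \<in> ann v"
    using f null_mult[OF poly_mat_carrier[OF X] c] v by (simp add: ann_def poly_mat_mult_vec[OF X v])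
  assume "g \<in> ann v"
  then show "f + g \<in> ann v"
    using f carrier_vecD[OF c[of f]] carrier_vecD[OF c[of g]] class_ideal_add[OF P]
    by (simp add: ann_def null_def poly_mat_add_vec[OF X v] del: index_mult_mat_vec dim_mult_mat_vec)
qed

lemma coeffs_in_imp_ann:
  assumes v: "v \<in> carrier_vec n" and f: "\<And>k. poly.coeff f k \<in> P"
  shows "f \<in> ann v"
proof -
  have "poly_mat f X $$ (i,j) \<in> P" if "i < n" "j < n" for i j
    using f that by (subst poly_mat_index[OF X that order.refl])
      (auto intro!: class_ideal_sum[OF P] class_ideal_mult'[OF P])
  then show ?thesis
    using class_ideal_mult_mat_vec[OF P poly_mat_carrier[OF X] v] by (auto simp: ann_def null_def)
qed

text \<open>A column of M with an entry outside P is annihilated by the characteristic polynomial.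
  This is what allows a minimal degree to be chosen.\<close>

lemma exists_monic_ann:
  "\<exists>g v. lead_coeff g = 1 \<and> v \<in> V \<and> \<not> null v \<and> g \<in> ann v"
proof -
  obtain i j where ij: "i < n" "j < n" "M $$ (i,j) \<notin> P"
    using M_notin by auto
  define v where "v = M *\<^sub>v unit_vec n j"
  have "v $ i = M $$ (i,j)"
    using M ij by (simp add: v_def)
  then have "\<not> null v"
    using ij by (auto simp: null_def)
  moreover have v: "v \<in> V"
    by (auto simp: V_def v_def)
  moreover have "char_poly X \<in> ann v"
    using Cayley_Hamilton_vec[OF X V_carrier[OF v]] class_ideal_zero[OF P]
    by (auto simp: ann_def null_def)
  ultimately show ?thesis
    using degree_monic_char_poly[OF X] by auto
qed

text \<open>Over the residue field, a monic polynomial \<open>g\<close> of minimal degree which annihilates some nonzero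
  vector of the image of \<open>M\<close> is irreducible, so it generates the maximal ideal of polynomials
  annihilating this vector.\<close>

context
  fixes g :: "'r poly" and v :: "'r vec"
  assumes monic: "lead_coeff g = 1" and v: "v \<in> V" and v_notin: "\<not> null v" and g: "g \<in> ann v"
    and minimal: "\<And>h w. lead_coeff h = 1 \<Longrightarrow> w \<in> V \<Longrightarrow> \<not> null w \<Longrightarrow> h \<in> ann w \<Longrightarrow> degree g \<le> degree h"
begin

text \<open>Otherwise the highest coefficient of r outside P, in some degree d below
  \<open>degree g\<close>, could be normalized to 1 modulo P, and a monic polynomial of degree d
  would annihilate w, against minimality.\<close>

lemma ann_low_degree:
  assumes w: "w \<in> V" "\<not> null w" and r: "r \<in> ann w"
    and deg: "\<And>k. degree g \<le> k \<Longrightarrow> poly.coeff r k \<in> P"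
  shows "poly.coeff r k \<in> P"
proof (rule ccontr)
  assume k: "poly.coeff r k \<notin> P"
  let ?D = "{k. poly.coeff r k \<notin> P}"
  have "?D \<subseteq> {..<degree g}"
    using deg not_less by auto
  then have fin: "finite ?D"
    by (rule finite_subset) simp
  define d where "d = Max ?D"
  have d: "poly.coeff r d \<notin> P"
    using Max_in[OF fin] k by (auto simp: d_def)
  have large: "poly.coeff r j \<in> P" if "d < j" for j
    using Max_ge[OF fin, of j] that by (auto simp: d_def)
  obtain b where b: "poly.coeff r d * b - 1 \<in> P"
    using unit[OF d] by auto
  \<comment> \<open>Multiply by the inverse modulo P, drop the terms above d, which lie in P, and
    make the coefficient at d exactly 1; all changes lie in P R[x].\<close>
  define h where "h = poly_cutoff d (Polynomial.smult b r) + Polynomial.monom 1 d"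
  have ch: "poly.coeff h j = (if j < d then b * poly.coeff r j else if j = d then 1 else 0)" for j
    by (auto simp: h_def coeff_poly_cutoff)
  have "degree h = d"
    by (rule antisym[OF degree_le le_degree]) (auto simp: ch)
  have "poly.coeff (Polynomial.smult b r - h) j \<in> P" for j
    using b large[of j] class_ideal_zero[OF P]
    by (auto simp: ch mult.commute intro: class_ideal_mult[OF P])
  then have "Polynomial.smult b r - h \<in> ann w"
    by (rule coeffs_in_imp_ann[OF V_carrier[OF w(1)]])
  moreover have "Polynomial.smult b r \<in> ann w"
    using class_ideal_mult[OF ideal_ann[OF V_carrier[OF w(1)]] r, of "[:b:]"] by simp
  ultimately have "h \<in> ann w"
    using class_ideal_diff[OF ideal_ann[OF V_carrier[OF w(1)]]] by fastforce
  then have "degree g \<le> degree h"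
    using w ch \<open>degree h = d\<close> by (intro minimal) auto
  then show False
    using deg d \<open>degree h = d\<close> by simp
qed

text \<open>The vector w = h(X) v is nonzero modulo P, lies in the image of M and is annihilated by
  f and g. The remainder of f modulo g annihilates w and has smaller degree than g, so it lies in P
  R[x]; thus f lies in (g) + P R[x].\<close>

lemma ann_prime:
  assumes fh: "f * h \<in> ann v" and h: "h \<notin> ann v"
  shows "f \<in> ann v"
proof -
  define w where "w = poly_mat h X *\<^sub>v v"
  note vc = V_carrier[OF v]
  have w: "w \<in> V" "\<not> null w"
    using poly_mat_V[OF v] h by (auto simp: w_def ann_def)
  note wc = V_carrier[OF w(1)]
  have f: "f \<in> ann w"
    using fh ann_mult_iff[OF vc] by (simp add: w_def)
  have gw: "g \<in> ann w"
    using class_ideal_mult'[OF ideal_ann[OF vc] g] ann_mult_iff[OF vc] by (simp add: w_def)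
  \<comment> \<open>Since g is monic, the pseudo-division introduces no scaling factor.\<close>
  obtain q r where qr: "pseudo_divmod f g = (q, r)"
    by force
  have "g \<noteq> 0" using monic by auto
  from pseudo_divmod[OF this qr] have fr: "f = g * q + r" and r: "r = 0 \<or> degree r < degree g"
    by (auto simp: monic)
  have "r = f - g * q"
    using fr by simp
  then have "r \<in> ann w"
    using class_ideal_diff[OF ideal_ann[OF wc] f class_ideal_mult'[OF ideal_ann[OF wc] gw]] by simp
  then have "poly.coeff r k \<in> P" for k
    using r class_ideal_zero[OF P] by (rule_tac ann_low_degree[OF w]) (auto simp: coeff_eq_0)
  then have "r \<in> ann v"
    by (rule coeffs_in_imp_ann[OF vc])
  then show ?thesis
    unfolding fr by (intro class_ideal_add[OF ideal_ann[OF vc]] class_ideal_mult'[OF ideal_ann[OF vc]] g)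
qed

lemma pderiv_char_poly_ann: "pderiv (char_poly X) \<in> ann v"
proof -
  let ?m = "ann v" and ?phi = "char_poly X"
  \<comment> \<open>N is an ideal containing m^2 and P R[x], by the product rule; membership
    directly records the statement about the derivative that is wanted.\<close>
  define N where "N = {f \<in> ?m. pderiv f \<in> ?m}"
  define C where "C = {f. \<forall>k. poly.coeff f k \<in> P}"
  define u where "u = poly_quot_vec g X v"
  note vc = V_carrier[OF v]
  note m = ideal_ann[OF vc]
  have C: "ideal C class_ring"
    unfolding C_def by (rule ideal_coeffs_in[OF P])
  have "C \<subseteq> N"
  proof
    fix f assume "f \<in> C"
    then have "poly.coeff f k \<in> P" for k by (simp add: C_def)
    moreover from this have "poly.coeff (pderiv f) k \<in> P" for k
      unfolding coeff_pderiv by (rule class_ideal_mult[OF P])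
    ultimately show "f \<in> N"
      by (auto simp: N_def intro: coeffs_in_imp_ann[OF vc])
  qed
  have N: "ideal N class_ring"
    unfolding ideal_class_ring_iff
    by (auto simp: N_def pderiv_add pderiv_mult class_ideal_zero[OF m] class_ideal_add[OF m]
        class_ideal_mult[OF m] class_ideal_mult'[OF m])
  have mm: "x * y \<in> N" if "x \<in> ?m" "y \<in> ?m" for x y
    using that by (auto simp: N_def pderiv_mult class_ideal_add[OF m] class_ideal_mult[OF m] class_ideal_mult'[OF m])
  have u: "u \<in> carrier_vec n"
    unfolding u_def by (rule poly_quot_vec_carrier[OF X])
  have cu: "poly.coeff (u $ i) k = (poly_mat (poly_shift (Suc k) g) X *\<^sub>v v) $ i" if "i < n" for i k
    unfolding u_def by (rule coeff_poly_quot_vec[OF X vc that])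
  have Xu: "(char_poly_matrix X *\<^sub>v u) $ i = Polynomial.smult (v $ i) g - [:(poly_mat g X *\<^sub>v v) $ i:]"
    if "i < n" for i
    unfolding u_def by (rule char_poly_matrix_mult_poly_quot_vec[OF X vc that])
  have Xu_in: "(char_poly_matrix X *\<^sub>v u) $ i \<in> ?m" if "i < n" for i
  proof -
    have "Polynomial.smult (v $ i) g \<in> ?m"
      using class_ideal_mult[OF m g, of "[:v $ i:]"] by simp
    moreover have "[:(poly_mat g X *\<^sub>v v) $ i:] \<in> ?m"
      using g that class_ideal_zero[OF P]
      by (intro coeffs_in_imp_ann[OF vc]) (auto simp: ann_def null_def coeff_pCons split: nat.split)
    ultimately show ?thesis
      unfolding Xu[OF that] by (rule class_ideal_diff[OF m])
  qed
  have iso: "(\<Sum>i<n. Polynomial.smult (w $ i) (u $ i)) \<in> C" if w: "w \<in> V" for w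
  proof -
    have "poly.coeff (\<Sum>i<n. Polynomial.smult (w $ i) (u $ i)) k = w \<bullet> (poly_mat (poly_shift (Suc k) g) X *\<^sub>v v)" for k
      using X by (simp add: coeff_sum cu scalar_prod_def lessThan_atLeast0)
    then show ?thesis
      using isotropic[OF w poly_mat_V[OF v]] by (simp add: C_def)
  qed
  have "u \<bullet> (char_poly_matrix X *\<^sub>v u) =
      (\<Sum>i<n. u $ i * (Polynomial.smult (v $ i) g - [:(poly_mat g X *\<^sub>v v) $ i:]))"
    using Xu carrier_matD[OF char_poly_matrix_closed[OF X]] by (simp add: scalar_prod_def lessThan_atLeast0)
  also have "\<dots> = g * (\<Sum>i<n. Polynomial.smult (v $ i) (u $ i)) -
      (\<Sum>i<n. Polynomial.smult ((poly_mat g X *\<^sub>v v) $ i) (u $ i))"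
    by (simp add: sum_distrib_left sum_subtractf right_diff_distrib mult.commute)
  also have "\<dots> \<in> C"
    by (intro class_ideal_diff[OF C] class_ideal_mult[OF C] iso v poly_mat_V)
  finally have uXu: "u \<bullet> (char_poly_matrix X *\<^sub>v u) \<in> N"
    using \<open>C \<subseteq> N\<close> by auto
  obtain i where i: "i < n" "v $ i \<notin> P"
    using v_notin by (auto simp: null_def)
  have one: "(poly_mat [:1:] X *\<^sub>v v) $ j = v $ j" if "j < n" for j
  proof -
    have "0\<^sub>m n n *\<^sub>v v = 0\<^sub>v n"
      using vc by (auto intro!: eq_vecI)
    then show ?thesis
      using mult_mat_vec_pCons[OF X vc that, of 1 0] X that by simp
  qed
  have "degree g \<noteq> 0"
  proof
    assume "degree g = 0"
    then have "g = [:1:]"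
      using monic by (auto elim!: degree_eq_zeroE)
    then show False
      using g v_notin one by (simp add: ann_def null_def)
  qed
  then obtain d where d: "degree g = Suc d"
    using not0_implies_Suc by blast
  \<comment> \<open>The polynomial \<open>u $ i\<close> has degree below \<open>degree g\<close>, so
    membership in m would put all its coefficients into P. Its coefficient at d = degree g - 1 is
    \<open>v $ i\<close>, because g is monic.\<close>
  have u_notin: "u $ i \<notin> ?m"
  proof
    assume *: "u $ i \<in> ?m"
    have "poly.coeff (u $ i) k = 0" if "degree g \<le> k" for k
      using that vc X i(1) by (simp add: cu[OF i(1)] poly_shift_eq_0)
    then have "poly.coeff (u $ i) d \<in> P"
      using class_ideal_zero[OF P] by (rule_tac ann_low_degree[OF v v_notin *]) simp
    moreover have "poly_shift (Suc d) g = [:1:]"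
      using pCons_poly_shift[of "Suc d" g] monic d by (simp add: poly_shift_eq_0)
    ultimately show False
      using i one by (simp add: cu[OF i(1)])
  qed
  have N_phi: "(u $ i)\<^sup>2 * ?phi \<in> N"
    unfolding char_poly_def
    by (rule symmetric_det_in_ideal[OF m N mm char_poly_matrix_closed[OF X] char_poly_matrix_symmetric[OF X sym] u Xu_in uXu i(1)])
  have cancel: "f \<in> ?m" if "f * (u $ i)\<^sup>2 \<in> ?m" for f
  proof -
    have "f * u $ i * u $ i \<in> ?m"
      using that by (simp add: power2_eq_square mult.assoc)
    then show ?thesis
      by (rule ann_prime[OF ann_prime[OF _ u_notin] u_notin])
  qed
  have "?phi * (u $ i)\<^sup>2 \<in> ?m"
    using N_phi by (simp add: N_def mult.commute)
  then have phi: "?phi \<in> ?m"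
    by (rule cancel)
  \<comment> \<open>By the product rule, with the characteristic polynomial already in m, only the
    term containing its derivative remains; primality of m then removes the square.\<close>
  have "pderiv ((u $ i)\<^sup>2 * ?phi) - ?phi * pderiv ((u $ i)\<^sup>2) \<in> ?m"
    using N_phi phi by (intro class_ideal_diff[OF m] class_ideal_mult'[OF m]) (auto simp: N_def)
  moreover have "pderiv ((u $ i)\<^sup>2 * ?phi) - ?phi * pderiv ((u $ i)\<^sup>2) = pderiv ?phi * (u $ i)\<^sup>2"
    unfolding pderiv_mult by (simp add: mult.commute)
  ultimately have "pderiv ?phi * (u $ i)\<^sup>2 \<in> ?m"
    by simp
  then show ?thesis
    by (rule cancel)
qed

end

lemma exists_pderiv_char_poly_ann: "\<exists>v \<in> V. \<not> null v \<and> pderiv (char_poly X) \<in> ann v"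
proof -
  \<comment> \<open>The minimum is taken over all vectors of V that are nonzero modulo P, since the
    primality argument passes from v to h(X) v.\<close>
  define S where "S = {d. \<exists>g v. lead_coeff g = 1 \<and> v \<in> V \<and> \<not> null v \<and> g \<in> ann v \<and> degree g = d}"
  have "\<exists>d. d \<in> S"
    using exists_monic_ann by (auto simp: S_def)
  then have "(LEAST d. d \<in> S) \<in> S"
    by (rule LeastI_ex)
  then obtain g v where gv: "lead_coeff g = 1" "v \<in> V" "\<not> null v" "g \<in> ann v"
    and d: "degree g = (LEAST d. d \<in> S)"
    by (auto simp: S_def)
  have "pderiv (char_poly X) \<in> ann v"
  proof (rule pderiv_char_poly_ann[OF gv])
    fix h w assume "lead_coeff h = 1" "w \<in> V" "\<not> null w" "h \<in> ann w"
    then have "degree h \<in> S"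
      by (auto simp: S_def)
    then show "degree g \<le> degree h"
      unfolding d by (rule Least_le)
  qed
  with gv show ?thesis
    by auto
qed

end

section \<open>The level\<close>

lemma finite_common_denominator:
  assumes "finite S"
  shows "\<exists>r :: 'r::idom. r \<noteq> 0 \<and> (\<forall>x\<in>S. to_fract r * x \<in> range to_fract)"
  using assms
proof (induction S)
  case empty
  then show ?case
    by (intro exI[of _ 1]) simp
next
  case (insert x S)
  then obtain r :: 'r where r: "r \<noteq> 0" "\<forall>x\<in>S. to_fract r * x \<in> range to_fract"
    by auto
  obtain a b where x: "x = Fract a b" "b \<noteq> 0"
    by (cases x)
  then have "to_fract b * x = to_fract a"
    by (simp add: to_fract_def eq_fract)
  then have "to_fract (r * b) * x = to_fract (r * a)"
    by (simp add: mult.assoc)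
  then have "to_fract (r * b) * x \<in> range to_fract"
    by (rule range_eqI)
  moreover have "to_fract (r * b) * y \<in> range to_fract" if "y \<in> S" for y
  proof -
    have "to_fract r * y \<in> range to_fract"
      using r(2) that by blast
    then obtain c where "to_fract r * y = to_fract c"
      by (rule rangeE)
    then have "to_fract (r * b) * y = to_fract (c * b)"
      by (simp add: mult_ac)
    then show ?thesis by (rule range_eqI)
  qed
  ultimately have "\<forall>y\<in>insert x S. to_fract (r * b) * y \<in> range to_fract"
    by blast
  moreover have "r * b \<noteq> 0"
    using r(1) x(2) by simp
  ultimately show ?case
    by blast
qed

lemma exists_nonzero_mat_level: "\<exists>r. r \<noteq> 0 \<and> r \<in> mat_level Q"
proof -
  have "finite (elements_mat Q)"
    by (simp add: elements_mat_def)
  then obtain r where "r \<noteq> 0" "\<forall>x\<in>elements_mat Q. to_fract r * x \<in> range to_fract"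
    using finite_common_denominator by blast
  then show ?thesis
    by (auto simp: mat_level_def integral_mat_iff elements_mat_def)
qed

lemma integral_mat_obtain:
  assumes "integral_mat A" "A \<in> carrier_mat n m"
  obtains B where "B \<in> carrier_mat n m" "A = map_mat to_fract B"
proof -
  define B where "B = mat n m (\<lambda>ij. SOME b. A $$ ij = to_fract b)"
  have "A $$ (i,j) = to_fract (B $$ (i,j))" if "i < n" "j < m" for i j
  proof -
    have "\<exists>b. A $$ (i,j) = to_fract b"
      using assms that by (auto simp: integral_mat_iff)
    from someI_ex[OF this] show ?thesis
      using that by (simp add: B_def)
  qed
  then have "A = map_mat to_fract B"
    using assms(2) by (auto simp: B_def intro!: eq_matI)
  moreover have "B \<in> carrier_mat n m"
    by (simp add: B_def)
  ultimately show ?thesis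
    using that by blast
qed

text \<open>Otherwise \<open>S\<close> contains \<open>a\<^sub>j\<close> with \<open>\<alpha>\<^sup>j a\<^sub>j = \<beta>\<^sup>j a\<close> for all \<open>j\<close>, and the colon ideals
  \<open>(aR : \<alpha>\<^sup>j)\<close> form a strictly increasing chain.\<close>

lemma noetherian_descent:
  assumes noeth: "noetherian_domain (class_ring :: 'r::idom ring)"
    and P: "primeideal P (class_ring :: 'r ring)" and ab: "\<alpha> \<in> P" "\<beta> \<notin> P"
    and a: "a \<in> S" "a \<noteq> 0"
  obtains b where "b \<in> S" "\<And>b'. b' \<in> S \<Longrightarrow> \<beta> * b \<noteq> \<alpha> * b'"
proof -
  have False if step: "\<forall>b\<in>S. \<exists>b'\<in>S. \<beta> * b = \<alpha> * b'"
  proof -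
    have Pi: "ideal P class_ring" "P \<noteq> UNIV" and pr: "\<And>x y. x * y \<in> P \<Longrightarrow> x \<in> P \<or> y \<in> P"
      using P by (auto simp: primeideal_class_ring_iff)
    have "\<exists>b\<in>S. \<alpha> ^ j * b = \<beta> ^ j * a" for j
    proof (induction j)
      case (Suc j)
      then obtain b b' where b: "b \<in> S" "\<alpha> ^ j * b = \<beta> ^ j * a" "b' \<in> S" "\<beta> * b = \<alpha> * b'"
        using step by blast
      have "\<alpha> ^ Suc j * b' = \<alpha> ^ j * (\<alpha> * b')" by (simp add: mult_ac)
      also have "\<dots> = \<beta> * (\<alpha> ^ j * b)" unfolding b(4)[symmetric] by (simp add: mult_ac)
      also have "\<dots> = \<beta> ^ Suc j * a" unfolding b(2) by (simp add: mult_ac)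
      finally show ?case using b(3) by blast
    qed (use a in auto)
    then obtain f where f: "\<And>j. \<alpha> ^ j * f j = \<beta> ^ j * a"
      by metis
    define D where "D m = {r. a dvd \<alpha> ^ m * r}" for m :: nat
    have "ideal (D m) class_ring" for m
      unfolding ideal_class_ring_iff by (auto simp: D_def distrib_left mult.left_commute[of _ _])
    moreover have mono: "D m \<subseteq> D k" if "m \<le> k" for m k
    proof
      fix r assume "r \<in> D m"
      then have "a dvd \<alpha> ^ (k - m) * (\<alpha> ^ m * r)"
        by (simp add: D_def)
      then show "r \<in> D k"
        using that by (simp add: D_def flip: mult.assoc power_add)
    qed
    ultimately have "subset.chain {I. ideal I class_ring} (range D)"
      by (auto simp: subset_chain_def) (metis nat_le_linear subsetD)
    then have "\<Union>(range D) \<in> range D"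
      using noeth by (intro noetherian_ring.ideal_chain_is_trivial[of class_ring]) (auto simp: noetherian_domain_def)
    then obtain m where m: "\<Union>(range D) = D m" by auto
    have "f (Suc m) \<in> D (Suc m)"
      unfolding D_def mem_Collect_eq f by simp
    then have "f (Suc m) \<in> D m"
      using m by blast
    then obtain r where r: "\<alpha> ^ m * f (Suc m) = a * r"
      by (auto simp: D_def)
    \<comment> \<open>If the chain stops at m, cancelling a leaves a power of \<beta> in \<alpha> R
      and so in P, although \<beta> is outside P.\<close>
    have "a * \<beta> ^ Suc m = \<alpha> * (\<alpha> ^ m * f (Suc m))"
      using f[of "Suc m"] by (simp add: mult_ac)
    also have "\<dots> = a * (\<alpha> * r)"
      unfolding r by (simp add: mult_ac)
    finally have "\<beta> ^ Suc m = \<alpha> * r"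
      using a(2) by (simp del: power_Suc)
    then have *: "\<beta> ^ Suc m \<in> P"
      using class_ideal_mult'[OF Pi(1) ab(1)] by simp
    have "\<beta> ^ k \<notin> P" for k
    proof (induction k)
      case 0
      have "x \<in> P" if "1 \<in> P" for x
        using class_ideal_mult[OF Pi(1) that, of x] by simp
      then show ?case using Pi(2) by auto
    qed (use pr ab in auto)
    then show False using * by blast
  qed
  then show ?thesis
    using that by blast
qed

interpretation to_fract_hom: inj_comm_ring_hom "to_fract :: 'r::idom \<Rightarrow> 'r fract"
  by unfold_locales auto

text \<open>Descent yields an a in the level for which \<beta> a / \<alpha> is not in the level. If
  all entries of M = a Q were in P, then \<beta> times each entry would be divisible by \<alpha>,
  and \<beta> a / \<alpha> would lie in the level after all.\<close>

lemma exists_scaling: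
  assumes dedekind: "dedekind_domain (class_ring :: 'r::idom ring)"
    and P: "primeideal P (class_ring :: 'r ring)"
    and ab: "\<alpha> \<in> P" "\<beta> \<notin> P" "\<And>p. p \<in> P \<Longrightarrow> \<alpha> dvd \<beta> * p" and alpha: "\<alpha> \<noteq> 0"
    and Q: "Q \<in> carrier_mat n m" and L: "mat_level Q \<subseteq> P"
  shows "\<exists>a M. a \<in> P \<and> M \<in> carrier_mat n m \<and> map_mat to_fract M = to_fract a \<cdot>\<^sub>m Q \<and>
    (\<exists>i<n. \<exists>j<m. M $$ (i,j) \<notin> P)"
proof -
  have Pi: "ideal P class_ring"
    using P by (simp add: primeideal_class_ring_iff)
  obtain r where r: "r \<noteq> 0" "r \<in> mat_level Q"
    using exists_nonzero_mat_level by blast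
  moreover have "noetherian_domain (class_ring :: 'r ring)"
    using dedekind by (simp add: dedekind_domain_def)
  ultimately obtain a where a: "a \<in> mat_level Q" and max: "\<And>a'. a' \<in> mat_level Q \<Longrightarrow> \<beta> * a \<noteq> \<alpha> * a'"
    using noetherian_descent[OF _ P(1) ab(1,2) _ r(1)] by metis
  have "integral_mat (to_fract a \<cdot>\<^sub>m Q)" "to_fract a \<cdot>\<^sub>m Q \<in> carrier_mat n m"
    using a Q by (simp_all add: mat_level_def)
  then obtain M where M: "M \<in> carrier_mat n m" "map_mat to_fract M = to_fract a \<cdot>\<^sub>m Q"
    by (metis integral_mat_obtain)
  have ent: "to_fract a * Q $$ (i,j) = to_fract (M $$ (i,j))" if "i < n" "j < m" for i j
    using arg_cong[OF M(2), of "\<lambda>A. A $$ (i,j)"] that M(1) Q by simp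
  have "\<exists>i<n. \<exists>j<m. M $$ (i,j) \<notin> P"
  proof (rule ccontr)
    assume "\<not> ?thesis"
    then have MP: "M $$ (i,j) \<in> P" if "i < n" "j < m" for i j
      using that by blast
    obtain a' where a': "\<beta> * a = \<alpha> * a'"
      using ab(3)[OF subsetD[OF L a]] by (rule dvdE)
    have "to_fract a' * Q $$ (i,j) \<in> range to_fract" if ij: "i < n" "j < m" for i j
    proof -
      obtain c where c: "\<beta> * M $$ (i,j) = \<alpha> * c"
        using ab(3)[OF MP[OF ij]] by (rule dvdE)
      have "to_fract \<alpha> * (to_fract a' * Q $$ (i,j)) = to_fract (\<alpha> * a') * Q $$ (i,j)"
        by (simp add: mult_ac)
      also have "\<dots> = to_fract \<beta> * (to_fract a * Q $$ (i,j))"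
        unfolding a'[symmetric] by (simp add: mult_ac)
      also have "\<dots> = to_fract \<alpha> * to_fract c"
        unfolding ent[OF ij] using c by (metis to_fract_mult)
      finally have "to_fract a' * Q $$ (i,j) = to_fract c"
        using alpha by simp
      then show ?thesis by simp
    qed
    then have "a' \<in> mat_level Q"
      using Q by (auto simp: mat_level_def integral_mat_iff)
    then show False
      using max a' by blast
  qed
  then show ?thesis
    using a L M by blast
qed

section \<open>Contradiction at a prime containing the level\<close>

theorem corollary2p2:
  fixes X Y :: "'r::idom mat" and Q :: "'r fract mat" and n :: nat and e :: "'r set \<Rightarrow> nat"
  assumes "dedekind_domain (class_ring :: 'r ring)"
    and "X \<in> carrier_mat n n" and "transpose_mat X = X"
    and "Y \<in> carrier_mat n n"
    and "Q \<in> carrier_mat n n" and "Q \<noteq> 0\<^sub>m n n"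
    and "map_mat to_fract X * Q = Q * map_mat to_fract Y"
    and "integral_mat (transpose_mat Q * Q)"
    and "mat_discriminant X \<noteq> 0"
    and "prime_ideal_factorization class_ring (PIdl\<^bsub>class_ring\<^esub> (mat_discriminant X)) e"
    and "\<forall>P. e P \<le> 1"
  shows "mat_level Q = UNIV"
proof (rule ccontr)
  note dedekind = assms(1) and X = assms(2) and sym = assms(3) and Y = assms(4) and Q = assms(5)
  assume L: "mat_level Q \<noteq> UNIV"
  let ?d = "mat_discriminant X"
  have "mat_level Q \<noteq> {0}"
    using exists_nonzero_mat_level[of Q] by auto
  then obtain P where P: "primeideal P class_ring" "P \<noteq> {0}" "mat_level Q \<subseteq> P"
    using exists_prime_superset[OF dedekind ideal_mat_level _ L] by blast
  have Pi: "ideal P class_ring" and pr: "\<And>x y. x * y \<in> P \<Longrightarrow> x \<in> P \<or> y \<in> P"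
    using P(1) by (auto simp: primeideal_class_ring_iff)
  obtain \<alpha> \<beta> where alpha: "\<alpha> \<noteq> 0" and ab: "\<alpha> \<in> P" "\<beta> \<notin> P" "\<And>p. p \<in> P \<Longrightarrow> \<alpha> dvd \<beta> * p"
    using exists_local_uniformizer[OF dedekind P(1,2)] by blast
  obtain a M where a: "a \<in> P" and M: "M \<in> carrier_mat n n"
    and Ma: "map_mat to_fract M = to_fract a \<cdot>\<^sub>m Q" and M_notin: "\<exists>i<n. \<exists>j<n. M $$ (i,j) \<notin> P"
    using exists_scaling[OF dedekind P(1) ab alpha Q P(3)] by blast
  \<comment> \<open>N plays the role of P^2: as \<beta> P lies in \<alpha> R, products of two
    elements of P belong to it.\<close>
  define N where "N = {z. \<alpha>\<^sup>2 dvd \<beta>\<^sup>2 * z}"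
  have N: "ideal N class_ring"
    unfolding ideal_class_ring_iff by (auto simp: N_def distrib_left mult.left_commute)
  have PN: "x * y \<in> N" if "x \<in> P" "y \<in> P" for x y
  proof -
    have "\<alpha> * \<alpha> dvd (\<beta> * x) * (\<beta> * y)"
      using ab(3) that by (intro mult_dvd_mono)
    then show ?thesis
      by (simp add: N_def power2_eq_square mult_ac)
  qed
  have beta2: "\<beta>\<^sup>2 \<notin> P"
    using pr ab(2) by (auto simp: power2_eq_square)
  have NP: "N \<subseteq> P"
  proof
    fix z assume "z \<in> N"
    then obtain w where "\<beta>\<^sup>2 * z = \<alpha> * (\<alpha> * w)"
      unfolding N_def mem_Collect_eq power2_eq_square mult.assoc dvd_def by blast
    then have "\<beta>\<^sup>2 * z \<in> P"
      using class_ideal_mult'[OF Pi ab(1)] by simp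
    then show "z \<in> P"
      using pr beta2 by blast
  qed
  have MM: "(transpose_mat M * M) $$ (i,j) \<in> N" if ij: "i < n" "j < n" for i j
  proof -
    have "transpose_mat Q * Q \<in> carrier_mat n n" using Q by simp
    then obtain G where G: "G \<in> carrier_mat n n" "transpose_mat Q * Q = map_mat to_fract G"
      using assms(8) integral_mat_obtain by blast
    have "map_mat to_fract (transpose_mat M * M) = transpose_mat (map_mat to_fract M) * map_mat to_fract M"
      using M by (simp add: to_fract_hom.mat_hom_mult[of _ n n _ n] map_mat_transpose)
    also have "\<dots> = (to_fract a * to_fract a) \<cdot>\<^sub>m (transpose_mat Q * Q)"
      unfolding Ma using Q by (auto intro!: eq_matI simp: mult.assoc)
    finally have eq: "map_mat to_fract (transpose_mat M * M) = (to_fract a * to_fract a) \<cdot>\<^sub>m map_mat to_fract G"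
      by (simp only: G(2))
    have "to_fract ((transpose_mat M * M) $$ (i,j)) = to_fract (a * a * G $$ (i,j))"
      using arg_cong[OF eq, of "\<lambda>A. A $$ (i,j)"] ij M G(1) by (simp del: index_mult_mat(1) add: index_mult_mat(2,3))
    then have "(transpose_mat M * M) $$ (i,j) = a * a * G $$ (i,j)"
      by (simp only: to_fract_hom.eq_iff)
    then show ?thesis
      using class_ideal_mult'[OF N PN[OF a a]] by simp
  qed
  have XM: "X * M = M * Y"
  proof -
    have "map_mat to_fract (X * M) = map_mat to_fract X * (to_fract a \<cdot>\<^sub>m Q)"
      using X M Ma by (simp add: to_fract_hom.mat_hom_mult[of _ n n _ n])
    also have "\<dots> = (to_fract a \<cdot>\<^sub>m Q) * map_mat to_fract Y"
      using X Y Q assms(7) by (simp add: mult_smult_distrib[of _ n n _ n] mult_smult_assoc_mat[of _ n n _ n])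
    also have "\<dots> = map_mat to_fract (M * Y)"
      using Y M Ma by (simp add: to_fract_hom.mat_hom_mult[of _ n n _ n])
    finally show ?thesis
      by (rule to_fract_hom.mat_hom_inj)
  qed
  interpret im: isotropic_image P n X Y M
  proof (rule isotropic_image.intro)
    show "\<exists>b. a * b - 1 \<in> P" if "a \<notin> P" for a
      by (rule nonzero_prime_unit[OF dedekind P(1,2) that])
    show "(transpose_mat M * M) $$ (i,j) \<in> P" if "i < n" "j < n" for i j
      by (rule subsetD[OF NP MM[OF that]])
  qed (fact P(1) X sym Y M XM M_notin)+
  obtain v where v: "v \<in> im.V" "\<not> im.null v" "pderiv (char_poly X) \<in> im.ann v"
    using im.exists_pderiv_char_poly_ann by blast
  let ?S = "poly_mat (pderiv (char_poly X)) X"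
  obtain i where i: "i < n" "v $ i \<notin> P"
    using v(2) by (auto simp: im.null_def)
  have "(v $ i)\<^sup>2 * det ?S \<in> N"
  proof (rule symmetric_det_in_ideal[OF Pi N PN poly_mat_carrier[OF X] poly_mat_symmetric[OF X sym] im.V_carrier[OF v(1)] _ _ i(1)])
    show "(?S *\<^sub>v v) $ j \<in> P" if "j < n" for j
      using v(3) that by (simp add: im.ann_def im.null_def)
    show "v \<bullet> (?S *\<^sub>v v) \<in> N"
      by (rule im.V_scalar_prod_in[OF N MM v(1) im.poly_mat_V[OF v(1)]])
  qed
  then obtain z where z: "\<beta>\<^sup>2 * ((v $ i)\<^sup>2 * ?d) = \<alpha>\<^sup>2 * z"
    unfolding mat_discriminant_def N_def mem_Collect_eq by (rule dvdE)
  define s where "s = \<beta>\<^sup>2 * (v $ i)\<^sup>2"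
  have s: "s \<notin> P"
    using pr i(2) ab(2) by (auto simp: s_def power2_eq_square)
  have sd: "s * ?d = \<alpha> * (\<alpha> * z)"
    using z by (simp add: s_def mult.assoc power2_eq_square)
  then have "s * ?d \<in> P"
    using class_ideal_mult'[OF Pi ab(1)] by simp
  then have d: "?d \<in> P"
    using pr s by blast
  \<comment> \<open>By the exponent bound the discriminant divides y \<alpha>, while s times the
    discriminant is divisible by \<alpha>^2. Cancelling one \<alpha> puts s y into P, although
    neither s nor y is in P.\<close>
  obtain y where y: "y \<notin> P" "\<And>p. p \<in> P \<Longrightarrow> ?d dvd y * p"
    using simple_prime_factor_cofactor[OF dedekind P(1) d assms(10)] assms(11) by blast
  obtain w where w: "y * \<alpha> = ?d * w"
    using y(2)[OF ab(1)] by (rule dvdE)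
  have "\<alpha> * (s * y) = s * (y * \<alpha>)"
    by (simp add: mult_ac)
  also have "\<dots> = (s * ?d) * w"
    unfolding w by (simp add: mult_ac)
  also have "\<dots> = \<alpha> * (\<alpha> * (z * w))"
    unfolding sd by (simp add: mult_ac)
  finally have "s * y = \<alpha> * (z * w)"
    using alpha by simp
  then have "s * y \<in> P"
    using class_ideal_mult'[OF Pi ab(1)] by simp
  then show False
    using pr s y(1) by blast
qed

end
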